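(* Let $\mathcal{B}$ be a Hopf algebra with antipode $S$, let $\psi:\mathcal{B}\to\mathbb{C}$ be a commuting, normalized linear functional, and let $(\mu_t)_{t\in\mathbb{R}}$ be the trivial deformation $$\mu_t=\Phi_t\circ\mu\circ(\Phi_t^{-1}\otimes\Phi_t^{-1}),\qquad \Phi_t=\mathrm{id}\star e_\star^{-t\psi}.$$ Then $$S_t=\Phi_t\circ S\circ\Phi_t=S\star e_\star^{-t(\psi\circ S+\psi)}$$ is the deformed antipode for every $t\in\mathbb{R}$, i.e. $\mu_t\circ(S_t\otimes\mathrm{id})\circ\Delta=\mu_t\circ(\mathrm{id}\otimes S_t)\circ\Delta=\mathbf 1\delta$; so $(\mu_t)_{t\in\mathbb{R}}$ is a Hopf deformation.
   Context: All vector spaces are over $\mathbb{C}$. $(\mathcal{B},\mu,\mathbf 1,\Delta,\delta)$: multiplication, unit, comultiplication, counit; $\mathbf 1\delta$ is the map $a\mapsto\delta(a)\mathbf 1$. For linear $\varphi,\varphi':\mathcal{B}\to\mathbb{C}$ and $T:\mathcal{B}\to\mathcal{B}$: $(\varphi\star\varphi')(a)=\varphi(a_{(1)})\varphi'(a_{(2)})$, $(T\star\varphi)(a)=T(a_{(1)})\varphi(a_{(2)})$, $(\varphi\star T)(a)=\varphi(a_{(1)})T(a_{(2)})$; $e_\star^{\varphi}=\sum_{n\ge0}\varphi^{\star n}/n!$ (pointwise convergent), with $\varphi^{\star0}=\delta$. A functional $\psi$ is commuting if $\psi\star\mathrm{id}=\mathrm{id}\star\psi$, and normalized if $\psi(\mathbf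 1)=0$. The maps $\Phi_t$ satisfy $\Phi_t\circ\Phi_s=\Phi_{t+s}$, so $\Phi_t^{-1}=\Phi_{-t}$. A trivial deformation is an additive deformation of the form above; its generator is $L=\partial\psi$, $\partial\psi(a\otimes b)=\delta(a)\psi(b)-\psi(ab)+\psi(a)\delta(b)$, and $\mu_t=\mu\star e_\star^{tL}$ (convolution over the coalgebra $\mathcal{B}\otimes\mathcal{B}$). In general an additive deformation is a family of unital multiplications $\mu_t$ on $\mathcal{B}$ with unit $\mathbf 1$, $\mu_0=\mu$, such that $\Delta:(\mathcal{B},\mu_{t+s})\to(\mathcal{B},\mu_t)\otimes(\mathcal{B},\mu_s)$ is an algebra homomorphism and $\delta\circ\mu_t\to\delta\otimes\delta$ pointwise as $t\to0$. It is a Hopf deformation if for all $t\in\mathbb{R}$ there is a linear map $S_t:\mathcal{B}\to\mathcal{B}$ (the deformed antipode, necessarily unique) with $\mu_t\circ(S_t\otimes\mathrm{id})\circ\Delta=\mu_t\circ(\mathrm{id}\otimes S_t)\circ\Delta=\mathbf 1\delta$. *)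

theory Defs
  imports Complex_Main "HOL-Library.Poly_Mapping"
begin

section \<open>Complex vector spaces\<close>

class scaleC =
  fixes scaleC :: "complex \<Rightarrow> 'a \<Rightarrow> 'a"  (infixr "*\<^sub>C" 75)

class complex_vector = scaleC + ab_group_add +
  assumes scaleC_add_right: "c *\<^sub>C (x + y) = c *\<^sub>C x + c *\<^sub>C y"
    and scaleC_add_left: "(c + d) *\<^sub>C x = c *\<^sub>C x + d *\<^sub>C x"
    and scaleC_scaleC: "c *\<^sub>C d *\<^sub>C x = (c * d) *\<^sub>C x"
    and scaleC_one: "1 *\<^sub>C x = x"

global_interpretation cvec: vector_space "scaleC :: complex \<Rightarrow> 'a \<Rightarrow> 'a::complex_vector"
  by unfold_locales (rule scaleC_add_right scaleC_add_left scaleC_scaleC scaleC_one)+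

abbreviation clinear :: "('a::complex_vector \<Rightarrow> 'b::complex_vector) \<Rightarrow> bool"
  where "clinear \<equiv> Vector_Spaces.linear scaleC scaleC"

definition cbilinear :: "('a::complex_vector \<Rightarrow> 'b::complex_vector \<Rightarrow> 'c::complex_vector) \<Rightarrow> bool"
  where "cbilinear f \<longleftrightarrow> (\<forall>a. clinear (f a)) \<and> (\<forall>b. clinear (\<lambda>a. f a b))"

lemma clinearI:
  assumes "\<And>x y. f (x + y) = f x + f y" and "\<And>c x. f (c *\<^sub>C x) = c *\<^sub>C f x"
  shows "clinear f"
  using assms by (simp add: Vector_Spaces.linear_iff cvec.vector_space_axioms)

lemma clinear_add: "clinear f \<Longrightarrow> f (x + y) = f x + f y"
  and clinear_scale: "clinear f \<Longrightarrow> f (c *\<^sub>C x) = c *\<^sub>C f x"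
  by (simp_all add: Vector_Spaces.linear_iff)

instantiation complex :: complex_vector
begin
definition scaleC_complex :: "complex \<Rightarrow> complex \<Rightarrow> complex"
  where "scaleC_complex c x = c * x"
instance
  by standard (simp_all add: scaleC_complex_def algebra_simps)
end

instantiation poly_mapping :: (type, complex_vector) complex_vector
begin
definition scaleC_poly_mapping :: "complex \<Rightarrow> ('a \<Rightarrow>\<^sub>0 'b) \<Rightarrow> ('a \<Rightarrow>\<^sub>0 'b)"
  where "scaleC_poly_mapping c = Poly_Mapping.map (scaleC c)"

lemma lookup_scaleC: "Poly_Mapping.lookup (c *\<^sub>C p) k = c *\<^sub>C Poly_Mapping.lookup p k"
  for p :: "'a \<Rightarrow>\<^sub>0 'b"
  by (simp add: scaleC_poly_mapping_def Poly_Mapping.map.rep_eq when_def)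

instance
  by standard
    (rule poly_mapping_eqI,
      simp add: lookup_scaleC lookup_add scaleC_add_right scaleC_add_left scaleC_scaleC scaleC_one)+
end

section \<open>Tensor products\<close>

text \<open>The tensor product is the free vector space on the pairs modulo the bilinearity relations.\<close>

definition tensor_relators :: "('a::complex_vector \<times> 'b::complex_vector \<Rightarrow>\<^sub>0 complex) set"
  where "tensor_relators =
    {Poly_Mapping.single (a + a', b) 1 - Poly_Mapping.single (a, b) 1
       - Poly_Mapping.single (a', b) 1 | a a' b. True}
    \<union> {Poly_Mapping.single (a, b + b') 1 - Poly_Mapping.single (a, b) 1
       - Poly_Mapping.single (a, b') 1 | a b b'. True}
    \<union> {Poly_Mapping.single (c *\<^sub>C a, b) 1 - c *\<^sub>C Poly_Mapping.single (a, b) 1 | c a b. True}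
    \<union> {Poly_Mapping.single (a, c *\<^sub>C b) 1 - c *\<^sub>C Poly_Mapping.single (a, b) 1 | c a b. True}"

definition tensor_rel ::
  "('a::complex_vector \<times> 'b::complex_vector \<Rightarrow>\<^sub>0 complex) \<Rightarrow> ('a \<times> 'b \<Rightarrow>\<^sub>0 complex) \<Rightarrow> bool"
  where "tensor_rel p q \<longleftrightarrow> p - q \<in> cvec.span tensor_relators"

lemma equivp_tensor_rel:
  "equivp (tensor_rel :: ('a::complex_vector \<times> 'b::complex_vector \<Rightarrow>\<^sub>0 complex) \<Rightarrow> _)"
proof (rule equivpI)
  show "reflp tensor_rel"
    by (rule reflpI) (simp add: tensor_rel_def cvec.span_zero)
  show "symp tensor_rel"
    unfolding tensor_rel_def by (rule sympI) (use cvec.span_neg in fastforce)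
  show "transp (tensor_rel :: ('a \<times> 'b \<Rightarrow>\<^sub>0 complex) \<Rightarrow> _)"
  proof (rule transpI)
    fix p q r :: "'a \<times> 'b \<Rightarrow>\<^sub>0 complex"
    assume "tensor_rel p q" "tensor_rel q r"
    then show "tensor_rel p r"
      unfolding tensor_rel_def using cvec.span_add[of "p - q" _ "q - r"] by simp
  qed
qed

quotient_type (overloaded) ('a, 'b) tensor  (infixl "\<otimes>" 70) =
  "('a::complex_vector \<times> 'b::complex_vector) \<Rightarrow>\<^sub>0 complex" / tensor_rel
  by (rule equivp_tensor_rel)

instantiation tensor :: (complex_vector, complex_vector) complex_vector
begin

lift_definition zero_tensor :: "'a \<otimes> 'b" is 0 .

lift_definition plus_tensor :: "'a \<otimes> 'b \<Rightarrow> 'a \<otimes> 'b \<Rightarrow> 'a \<otimes> 'b" is "(+)"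
  unfolding tensor_rel_def add_diff_add by (rule cvec.span_add)

lift_definition uminus_tensor :: "'a \<otimes> 'b \<Rightarrow> 'a \<otimes> 'b" is uminus
  unfolding tensor_rel_def minus_diff_minus by (rule cvec.span_neg)

lift_definition minus_tensor :: "'a \<otimes> 'b \<Rightarrow> 'a \<otimes> 'b \<Rightarrow> 'a \<otimes> 'b" is "(-)"
proof -
  fix p p' q q' :: "'a \<times> 'b \<Rightarrow>\<^sub>0 complex"
  assume "tensor_rel p p'" "tensor_rel q q'"
  moreover have "p - q - (p' - q') = (p - p') - (q - q')" by simp
  ultimately show "tensor_rel (p - q) (p' - q')"
    unfolding tensor_rel_def by (simp only: cvec.span_diff)
qed

lift_definition scaleC_tensor :: "complex \<Rightarrow> 'a \<otimes> 'b \<Rightarrow> 'a \<otimes> 'b" is scaleC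
  unfolding tensor_rel_def cvec.scale_right_diff_distrib[symmetric] by (rule cvec.span_scale)

instance
  by standard
    (transfer, simp add: tensor_rel_def cvec.span_zero algebra_simps
      scaleC_add_right scaleC_add_left scaleC_scaleC scaleC_one)+

end

lift_definition tensor :: "'a::complex_vector \<Rightarrow> 'b::complex_vector \<Rightarrow> 'a \<otimes> 'b"  (infixl "\<otimes>" 70)
  is "\<lambda>a b. Poly_Mapping.single (a, b) 1" .

text \<open>
  \<open>tensor_lift f\<close> is the linear map with \<open>tensor_lift f (a \<otimes> b) = f a b\<close>, for bilinear \<open>f\<close>.
  The representative picked by \<open>rep_tensor\<close> does not matter in that case;
  for other \<open>f\<close> the value is meaningless.
\<close>

definition free_lift :: "('a \<Rightarrow> 'b \<Rightarrow> 'c::complex_vector) \<Rightarrow> ('a \<times> 'b \<Rightarrow>\<^sub>0 complex) \<Rightarrow> 'c"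
  where "free_lift f p = (\<Sum>(a, b)\<in>Poly_Mapping.keys p. Poly_Mapping.lookup p (a, b) *\<^sub>C f a b)"

definition tensor_lift ::
  "('a::complex_vector \<Rightarrow> 'b::complex_vector \<Rightarrow> 'c::complex_vector) \<Rightarrow> 'a \<otimes> 'b \<Rightarrow> 'c"
  where "tensor_lift f t = free_lift f (rep_tensor t)"

lemma cbilinear_tensor: "cbilinear tensor"
  unfolding cbilinear_def
proof (intro conjI allI clinearI; transfer)
  fix a a' :: 'a and b b' :: 'b and c
  show "tensor_rel (Poly_Mapping.single (a, b + b') 1)
      (Poly_Mapping.single (a, b) 1 + Poly_Mapping.single (a, b') 1)"
    unfolding tensor_rel_def tensor_relators_def diff_diff_eq[symmetric]
    by (intro cvec.span_base) blast
  show "tensor_rel (Poly_Mapping.single (a, c *\<^sub>C b) 1) (c *\<^sub>C Poly_Mapping.single (a, b) 1)"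
    unfolding tensor_rel_def tensor_relators_def by (intro cvec.span_base) blast
  show "tensor_rel (Poly_Mapping.single (a + a', b) 1)
      (Poly_Mapping.single (a, b) 1 + Poly_Mapping.single (a', b) 1)"
    unfolding tensor_rel_def tensor_relators_def diff_diff_eq[symmetric]
    by (intro cvec.span_base) blast
  show "tensor_rel (Poly_Mapping.single (c *\<^sub>C a, b) 1) (c *\<^sub>C Poly_Mapping.single (a, b) 1)"
    unfolding tensor_rel_def tensor_relators_def by (intro cvec.span_base) blast
qed

lemma free_lift_superset:
  assumes "finite K" "Poly_Mapping.keys p \<subseteq> K"
  shows "free_lift f p = (\<Sum>(a, b)\<in>K. Poly_Mapping.lookup p (a, b) *\<^sub>C f a b)"
  unfolding free_lift_def
  by (rule sum.mono_neutral_left) (use assms in \<open>auto simp: in_keys_iff\<close>)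

lemma clinear_free_lift: "clinear (free_lift f)"
proof (rule clinearI)
  fix p q :: "'a \<times> 'b \<Rightarrow>\<^sub>0 complex" and c
  let ?K = "Poly_Mapping.keys p \<union> Poly_Mapping.keys q"
  have "free_lift f (p + q) = (\<Sum>(a, b)\<in>?K. Poly_Mapping.lookup (p + q) (a, b) *\<^sub>C f a b)"
    by (rule free_lift_superset) (use Poly_Mapping.keys_add[of p q] in auto)
  also have "\<dots> = (\<Sum>(a, b)\<in>?K. Poly_Mapping.lookup p (a, b) *\<^sub>C f a b) + (\<Sum>(a, b)\<in>?K. Poly_Mapping.lookup q (a, b) *\<^sub>C f a b)"
    by (simp add: lookup_add scaleC_add_left sum.distrib case_prod_unfold)
  also have "\<dots> = free_lift f p + free_lift f q"
    by (subst (1 2) free_lift_superset[of ?K]) auto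
  finally show "free_lift f (p + q) = free_lift f p + free_lift f q" .
  have "free_lift f (c *\<^sub>C p) = (\<Sum>(a, b)\<in>Poly_Mapping.keys p. Poly_Mapping.lookup (c *\<^sub>C p) (a, b) *\<^sub>C f a b)"
    by (rule free_lift_superset) (auto simp: in_keys_iff lookup_scaleC scaleC_complex_def)
  also have "\<dots> = c *\<^sub>C free_lift f p"
    by (simp add: free_lift_def lookup_scaleC scaleC_complex_def cvec.scale_sum_right
        scaleC_scaleC case_prod_unfold)
  finally show "free_lift f (c *\<^sub>C p) = c *\<^sub>C free_lift f p" .
qed

lemma free_lift_single: "free_lift f (Poly_Mapping.single (a, b) 1) = f a b"
  by (simp add: free_lift_def scaleC_one)

lemma free_lift_relators:
  assumes "cbilinear f" "p \<in> cvec.span tensor_relators"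
  shows "free_lift f p = 0"
proof -
  interpret Vector_Spaces.linear scaleC scaleC "free_lift f" by (rule clinear_free_lift)
  have lin: "clinear (f a)" "clinear (\<lambda>a. f a b)" for a b
    using assms(1) by (auto simp: cbilinear_def)
  have "tensor_relators \<subseteq> {p. free_lift f p = 0}"
    unfolding tensor_relators_def
    by (auto simp: diff scale free_lift_single clinear_add[OF lin(1)] clinear_add[OF lin(2)]
        clinear_scale[OF lin(1)] clinear_scale[OF lin(2)])
  then show ?thesis
    using cvec.span_minimal[OF _ subspace_kernel] assms(2) by blast
qed

lemma tensor_lift_abs:
  assumes "cbilinear f"
  shows "tensor_lift f (abs_tensor p) = free_lift f p"
proof -
  interpret Vector_Spaces.linear scaleC scaleC "free_lift f" by (rule clinear_free_lift)
  have "tensor_rel (rep_tensor (abs_tensor p)) p"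
    by (rule Quotient3_rep_abs[OF Quotient3_tensor]) (simp add: tensor_rel_def cvec.span_zero)
  then have "free_lift f (rep_tensor (abs_tensor p) - p) = 0"
    by (intro free_lift_relators[OF assms]) (simp add: tensor_rel_def)
  then show ?thesis
    by (simp add: tensor_lift_def diff)
qed

lemma clinear_tensor_lift:
  assumes "cbilinear f"
  shows "clinear (tensor_lift f)"
proof (rule clinearI)
  fix s t :: "'a \<otimes> 'b" and c
  obtain p where p: "s = abs_tensor p" by (metis Quotient3_tensor Quotient3_abs_rep)
  obtain q where q: "t = abs_tensor q" by (metis Quotient3_tensor Quotient3_abs_rep)
  show "tensor_lift f (s + t) = tensor_lift f s + tensor_lift f t"
    by (simp add: p q plus_tensor.abs_eq tensor_lift_abs[OF assms] clinear_add[OF clinear_free_lift])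
  show "tensor_lift f (c *\<^sub>C s) = c *\<^sub>C tensor_lift f s"
    by (simp add: p scaleC_tensor.abs_eq tensor_lift_abs[OF assms] clinear_scale[OF clinear_free_lift])
qed

lemma tensor_lift_tensor:
  assumes "cbilinear f"
  shows "tensor_lift f (a \<otimes> b) = f a b"
  by (simp add: tensor.abs_eq tensor_lift_abs[OF assms] free_lift_single)

lemma span_tensors: "cvec.span {a \<otimes> b | a b. True} = (UNIV :: ('a::complex_vector \<otimes> 'b::complex_vector) set)"
proof -
  have "t \<in> cvec.span {a \<otimes> b | a b. True}" for t :: "'a \<otimes> 'b"
  proof -
    obtain p where t: "t = abs_tensor p" by (metis Quotient3_tensor Quotient3_abs_rep)
    have "abs_tensor p \<in> cvec.span {a \<otimes> b | a b. True}"
    proof (induction p rule: update_induct)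
      case const
      then show ?case
        by (simp add: zero_tensor.abs_eq[symmetric] cvec.span_zero)
    next
      case (update p k v)
      have "Poly_Mapping.update k v p = p + v *\<^sub>C Poly_Mapping.single k 1"
        by (rule poly_mapping_eqI)
          (use update(1) in \<open>auto simp: lookup_update lookup_add lookup_scaleC lookup_single
            scaleC_complex_def when_def in_keys_iff\<close>)
      then have "abs_tensor (Poly_Mapping.update k v p) = abs_tensor p + v *\<^sub>C (fst k \<otimes> snd k)"
        by (simp add: tensor.abs_eq scaleC_tensor.abs_eq plus_tensor.abs_eq)
      moreover have "v *\<^sub>C (fst k \<otimes> snd k) \<in> cvec.span {a \<otimes> b | a b. True}"
        by (intro cvec.span_scale cvec.span_base) blast
      ultimately show ?case
        using update(3) by (simp add: cvec.span_add)
    qed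
    with t show ?thesis by simp
  qed
  then show ?thesis by blast
qed

definition tensor_map ::
  "('a::complex_vector \<Rightarrow> 'c::complex_vector) \<Rightarrow> ('b::complex_vector \<Rightarrow> 'd::complex_vector)
    \<Rightarrow> 'a \<otimes> 'b \<Rightarrow> 'c \<otimes> 'd"
  where "tensor_map f g = tensor_lift (\<lambda>a b. f a \<otimes> g b)"

definition tensor_assoc ::
  "('a::complex_vector \<otimes> 'b::complex_vector) \<otimes> 'c::complex_vector \<Rightarrow> 'a \<otimes> ('b \<otimes> 'c)"
  where "tensor_assoc = tensor_lift (\<lambda>x c. tensor_lift (\<lambda>a b. a \<otimes> (b \<otimes> c)) x)"

definition tensor_middle_swap ::
  "('a::complex_vector \<otimes> 'b::complex_vector) \<otimes> ('c::complex_vector \<otimes> 'd::complex_vector)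
    \<Rightarrow> ('a \<otimes> 'c) \<otimes> ('b \<otimes> 'd)"
  where "tensor_middle_swap =
    tensor_lift (\<lambda>x y. tensor_lift (\<lambda>a b. tensor_lift (\<lambda>c d. (a \<otimes> c) \<otimes> (b \<otimes> d)) y) x)"

section \<open>Hopf algebras\<close>

locale unital_algebra =
  fixes mult :: "'a::complex_vector \<otimes> 'a \<Rightarrow> 'a"
    and unit :: 'a
  assumes mult_linear: "clinear mult"
    and mult_assoc: "mult (mult (a \<otimes> b) \<otimes> c) = mult (a \<otimes> mult (b \<otimes> c))"
    and mult_unit_left: "mult (unit \<otimes> a) = a"
    and mult_unit_right: "mult (a \<otimes> unit) = a"

definition tensor_mult ::
  "('a::complex_vector \<otimes> 'a \<Rightarrow> 'a) \<Rightarrow> ('b::complex_vector \<otimes> 'b \<Rightarrow> 'b)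
    \<Rightarrow> ('a \<otimes> 'b) \<otimes> ('a \<otimes> 'b) \<Rightarrow> 'a \<otimes> 'b"
  where "tensor_mult m m' = tensor_map m m' \<circ> tensor_middle_swap"

definition algebra_hom ::
  "('a::complex_vector \<otimes> 'a \<Rightarrow> 'a) \<Rightarrow> 'a \<Rightarrow> ('b::complex_vector \<otimes> 'b \<Rightarrow> 'b) \<Rightarrow> 'b
    \<Rightarrow> ('a \<Rightarrow> 'b) \<Rightarrow> bool"
  where "algebra_hom m u m' u' f \<longleftrightarrow> clinear f \<and> f \<circ> m = m' \<circ> tensor_map f f \<and> f u = u'"

locale coalgebra =
  fixes comult :: "'a::complex_vector \<Rightarrow> 'a \<otimes> 'a"
    and counit :: "'a \<Rightarrow> complex"
  assumes comult_linear: "clinear comult"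
    and counit_linear: "clinear counit"
    and coassoc: "tensor_map id comult (comult a) = tensor_assoc (tensor_map comult id (comult a))"
    and counit_left: "tensor_lift (\<lambda>x y. counit x *\<^sub>C y) (comult a) = a"
    and counit_right: "tensor_lift (\<lambda>x y. counit y *\<^sub>C x) (comult a) = a"

locale bialgebra = unital_algebra mult unit + coalgebra comult counit
  for mult :: "'a::complex_vector \<otimes> 'a \<Rightarrow> 'a" and unit comult counit +
  assumes comult_hom: "algebra_hom mult unit (tensor_mult mult mult) (unit \<otimes> unit) comult"
    and counit_hom: "algebra_hom mult unit (tensor_lift (*)) 1 counit"

locale hopf_algebra = bialgebra mult unit comult counit
  for mult :: "'a::complex_vector \<otimes> 'a \<Rightarrow> 'a" and unit comult counit +
  fixes antipode :: "'a \<Rightarrow> 'a"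
  assumes antipode_linear: "clinear antipode"
    and antipode_left: "mult (tensor_map antipode id (comult a)) = counit a *\<^sub>C unit"
    and antipode_right: "mult (tensor_map id antipode (comult a)) = counit a *\<^sub>C unit"

section \<open>Convolution\<close>

definition conv_fun ::
  "('a::complex_vector \<Rightarrow> 'a \<otimes> 'a) \<Rightarrow> ('a \<Rightarrow> complex) \<Rightarrow> ('a \<Rightarrow> complex) \<Rightarrow> 'a \<Rightarrow> complex"
  where "conv_fun comult \<phi> \<phi>' a = tensor_lift (\<lambda>x y. \<phi> x * \<phi>' y) (comult a)"

definition conv_right ::
  "('a::complex_vector \<Rightarrow> 'a \<otimes> 'a) \<Rightarrow> ('a \<Rightarrow> 'a) \<Rightarrow> ('a \<Rightarrow> complex) \<Rightarrow> 'a \<Rightarrow> 'a"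
  where "conv_right comult T \<phi> a = tensor_lift (\<lambda>x y. \<phi> y *\<^sub>C T x) (comult a)"

definition conv_left ::
  "('a::complex_vector \<Rightarrow> 'a \<otimes> 'a) \<Rightarrow> ('a \<Rightarrow> complex) \<Rightarrow> ('a \<Rightarrow> 'a) \<Rightarrow> 'a \<Rightarrow> 'a"
  where "conv_left comult \<phi> T a = tensor_lift (\<lambda>x y. \<phi> x *\<^sub>C T y) (comult a)"

primrec conv_power ::
  "('a::complex_vector \<Rightarrow> 'a \<otimes> 'a) \<Rightarrow> ('a \<Rightarrow> complex) \<Rightarrow> ('a \<Rightarrow> complex) \<Rightarrow> nat \<Rightarrow> 'a \<Rightarrow> complex"
  where
    "conv_power comult counit \<phi> 0 = counit"
  | "conv_power comult counit \<phi> (Suc n) = conv_fun comult \<phi> (conv_power comult counit \<phi> n)"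

text \<open>
  For linear \<open>\<phi>\<close> on a coalgebra the series converges at every point, since each element lies in a
  finite-dimensional subcoalgebra; so \<open>suminf\<close> is the actual sum there.
\<close>

definition conv_exp ::
  "('a::complex_vector \<Rightarrow> 'a \<otimes> 'a) \<Rightarrow> ('a \<Rightarrow> complex) \<Rightarrow> ('a \<Rightarrow> complex) \<Rightarrow> 'a \<Rightarrow> complex"
  where "conv_exp comult counit \<phi> a = suminf (\<lambda>n. conv_power comult counit \<phi> n a / fact n)"

definition commuting :: "('a::complex_vector \<Rightarrow> 'a \<otimes> 'a) \<Rightarrow> ('a \<Rightarrow> complex) \<Rightarrow> bool"
  where "commuting comult \<psi> \<longleftrightarrow> conv_left comult \<psi> id = conv_right comult id \<psi>"

definition normalized :: "'a \<Rightarrow> ('a \<Rightarrow> complex) \<Rightarrow> bool"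
  where "normalized unit \<psi> \<longleftrightarrow> \<psi> unit = 0"

section \<open>Additive deformations\<close>

definition additive_deformation ::
  "('a::complex_vector \<otimes> 'a \<Rightarrow> 'a) \<Rightarrow> 'a \<Rightarrow> ('a \<Rightarrow> 'a \<otimes> 'a) \<Rightarrow> ('a \<Rightarrow> complex)
    \<Rightarrow> (real \<Rightarrow> 'a \<otimes> 'a \<Rightarrow> 'a) \<Rightarrow> bool"
  where "additive_deformation mult unit comult counit M \<longleftrightarrow>
    (\<forall>t. unital_algebra (M t) unit) \<and>
    M 0 = mult \<and>
    (\<forall>t s. algebra_hom (M (t + s)) unit (tensor_mult (M t) (M s)) (unit \<otimes> unit) comult) \<and>
    (\<forall>x. ((\<lambda>t. counit (M t x)) \<longlongrightarrow> tensor_lift (\<lambda>a b. counit a * counit b) x) (at 0))"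

definition deformed_antipode ::
  "('a::complex_vector \<otimes> 'a \<Rightarrow> 'a) \<Rightarrow> 'a \<Rightarrow> ('a \<Rightarrow> 'a \<otimes> 'a) \<Rightarrow> ('a \<Rightarrow> complex)
    \<Rightarrow> ('a \<Rightarrow> 'a) \<Rightarrow> bool"
  where "deformed_antipode m unit comult counit T \<longleftrightarrow>
    clinear T \<and>
    m \<circ> tensor_map T id \<circ> comult = (\<lambda>a. counit a *\<^sub>C unit) \<and>
    m \<circ> tensor_map id T \<circ> comult = (\<lambda>a. counit a *\<^sub>C unit)"

definition hopf_deformation ::
  "('a::complex_vector \<otimes> 'a \<Rightarrow> 'a) \<Rightarrow> 'a \<Rightarrow> ('a \<Rightarrow> 'a \<otimes> 'a) \<Rightarrow> ('a \<Rightarrow> complex)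
    \<Rightarrow> (real \<Rightarrow> 'a \<otimes> 'a \<Rightarrow> 'a) \<Rightarrow> bool"
  where "hopf_deformation mult unit comult counit M \<longleftrightarrow>
    additive_deformation mult unit comult counit M \<and>
    (\<forall>t. \<exists>T. deformed_antipode (M t) unit comult counit T)"

text \<open>
  \<open>deformation_flow comult counit \<psi> t\<close> is $\Phi_t = \mathrm{id} \star e_\star^{-t\psi}$. For linear \<open>\<psi>\<close>
  it is bijective with inverse $\Phi_{-t}$, so \<open>inv\<close> in \<open>trivial_deformation\<close> is the true inverse.
\<close>

definition deformation_flow ::
  "('a::complex_vector \<Rightarrow> 'a \<otimes> 'a) \<Rightarrow> ('a \<Rightarrow> complex) \<Rightarrow> ('a \<Rightarrow> complex) \<Rightarrow> real \<Rightarrow> 'a \<Rightarrow> 'a"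
  where "deformation_flow comult counit \<psi> t =
    conv_right comult id (conv_exp comult counit (\<lambda>a. - complex_of_real t * \<psi> a))"

definition trivial_deformation ::
  "('a::complex_vector \<otimes> 'a \<Rightarrow> 'a) \<Rightarrow> ('a \<Rightarrow> 'a \<otimes> 'a) \<Rightarrow> ('a \<Rightarrow> complex) \<Rightarrow> ('a \<Rightarrow> complex)
    \<Rightarrow> real \<Rightarrow> 'a \<otimes> 'a \<Rightarrow> 'a"
  where "trivial_deformation mult comult counit \<psi> t =
    (let \<Phi> = deformation_flow comult counit \<psi> t
     in \<Phi> \<circ> mult \<circ> tensor_map (inv \<Phi>) (inv \<Phi>))"

end

theory Submission
  imports Defs
begin

text \<open>
  Write \<open>e\<^sub>t\<close> for the convolution exponential of \<open>-t\<psi>\<close>, so that \<open>\<Phi>\<^sub>t(a) = a\<^sub>1 e\<^sub>t(a\<^sub>2)\<close>.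
  Three facts about \<open>e\<^sub>t\<close> carry the proof.

  First, the exponential series converges: an element \<open>a\<close> lies in a finite-dimensional space that
  convolution with a functional maps to itself, so the convolution powers of a functional grow at
  most geometrically at \<open>a\<close> (\<open>conv_power_bound\<close>). Hence a Cauchy product makes the exponential
  of a sum of two convolution-commuting functionals the convolution product of the exponentials
  (\<open>conv_exp_add\<close>), and \<open>\<Phi>\<close> is a one-parameter group.

  Second, \<open>\<psi>\<close> being commuting means that it is central for convolution with functionals
  (\<open>commuting_iff\<close>). This passes to each power and, by continuity of the series, to \<open>e\<^sub>t\<close>. So
  \<open>\<Phi>\<^sub>t(a) = e\<^sub>t(a\<^sub>1) a\<^sub>2\<close> as well, and by coassociativity \<open>\<Phi>\<close> may act on either leg of a coproduct:
  \<open>\<Delta> \<circ> \<Phi>\<^sub>t\<^sub>+\<^sub>s = (\<Phi>\<^sub>t \<otimes> \<Phi>\<^sub>s) \<circ> \<Delta>\<close> (\<open>comult_flow\<close>).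

  Third, \<open>\<mu>\<^sub>t\<close> is \<open>\<mu>\<close> transported along \<open>\<Phi>\<^sub>t\<close>. Associativity is therefore inherited,
  \<open>\<Phi>\<^sub>t\<close> fixes \<open>1\<close> because \<open>\<psi>\<close> is normalized, and \<open>comult_flow\<close> turns multiplicativity of \<open>\<Delta>\<close>
  into the homomorphism property of an additive deformation. The same identity at times \<open>t\<close> and \<open>-t\<close>
  gives \<open>\<Delta> = (\<Phi>\<^sub>-\<^sub>t \<otimes> \<Phi>\<^sub>t) \<circ> \<Delta>\<close>, and this reduces the antipode equation for
  \<open>\<Phi>\<^sub>t \<circ> S \<circ> \<Phi>\<^sub>t\<close> to the one for \<open>S\<close>:
  \<open>\<mu>\<^sub>t(\<Phi>\<^sub>t S \<Phi>\<^sub>t a\<^sub>1 \<otimes> a\<^sub>2) = \<mu>\<^sub>t(\<Phi>\<^sub>t S a\<^sub>1 \<otimes> \<Phi>\<^sub>t a\<^sub>2) = \<Phi>\<^sub>t(S(a\<^sub>1) a\<^sub>2) = \<delta>(a)1\<close>.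

  The closed form of \<open>\<Phi>\<^sub>t \<circ> S \<circ> \<Phi>\<^sub>t\<close> needs that \<open>S\<close> reverses the coproduct (\<open>comult_antipode\<close>).
  Then \<open>\<Phi>\<^sub>t \<circ> S = S \<star> (e\<^sub>t \<circ> S)\<close>, where \<open>e\<^sub>t \<circ> S\<close> is the exponential of \<open>-t(\<psi> \<circ> S)\<close>, and centrality
  of \<open>\<psi>\<close> lets the two exponentials be combined into one.
\<close>

section \<open>Linear maps out of tensor products\<close>

lemma cbilinearI:
  assumes "\<And>a. clinear (\<lambda>b. f a b)" "\<And>b. clinear (\<lambda>a. f a b)"
  shows "cbilinear f"
  using assms by (simp add: cbilinear_def)

lemma cbilinearD:
  assumes "cbilinear f"
  shows "clinear (f a)" "clinear (\<lambda>a. f a b)"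
  using assms by (simp_all add: cbilinear_def)

lemma clinear_compose:
  assumes "clinear f" "clinear g"
  shows "clinear (\<lambda>x. f (g x))"
  using assms by (intro clinearI) (simp_all add: clinear_add clinear_scale)

lemma clinear_sum:
  assumes "clinear f"
  shows "f (\<Sum>i\<in>I. g i) = (\<Sum>i\<in>I. f (g i))"
proof -
  interpret Vector_Spaces.linear scaleC scaleC f by (rule assms)
  show ?thesis by (rule sum)
qed

lemma clinear_ident: "clinear (\<lambda>x. x)"
  by (intro clinearI) simp_all

lemma clinear_plus: "clinear f \<Longrightarrow> clinear g \<Longrightarrow> clinear (\<lambda>x. f x + g x)"
  by (intro clinearI) (simp_all add: clinear_add clinear_scale scaleC_add_right)

lemma clinear_scaleC: "clinear f \<Longrightarrow> clinear (\<lambda>x. c *\<^sub>C f x)"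
  by (intro clinearI) (simp_all add: clinear_add clinear_scale scaleC_add_right scaleC_scaleC mult.commute)

lemma clinear_scaleC_left: "clinear f \<Longrightarrow> clinear (\<lambda>x. f x *\<^sub>C v)"
  by (intro clinearI) (simp_all add: clinear_add clinear_scale scaleC_add_left scaleC_scaleC scaleC_complex_def)

lemma clinear_times:
  fixes f :: "'a::complex_vector \<Rightarrow> complex"
  assumes "clinear f"
  shows "clinear (\<lambda>x. c * f x)" "clinear (\<lambda>x. f x * c)"
  using assms by (auto intro!: clinearI simp: clinear_add clinear_scale scaleC_complex_def algebra_simps)

lemma clinear_tensor:
  assumes "clinear f"
  shows "clinear (\<lambda>x. f x \<otimes> b)" "clinear (\<lambda>x. a \<otimes> f x)"
  using clinear_compose[OF cbilinearD(2)[OF cbilinear_tensor] assms]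
    clinear_compose[OF cbilinearD(1)[OF cbilinear_tensor] assms] by blast+

lemma clinear_tensor_lift_pointwise:
  assumes "\<And>u v. clinear (\<lambda>x. f x u v)"
  shows "clinear (\<lambda>x. tensor_lift (f x) t)"
  unfolding tensor_lift_def free_lift_def
  by (intro clinearI)
    (simp_all add: clinear_add[OF assms] clinear_scale[OF assms] case_prod_unfold scaleC_add_right
      sum.distrib cvec.scale_sum_right scaleC_scaleC mult.commute)

lemma clinear_tensor_lift_compose:
  assumes "\<And>a. clinear (\<lambda>b. f a b)" "\<And>b. clinear (\<lambda>a. f a b)" "clinear g"
  shows "clinear (\<lambda>x. tensor_lift f (g x))"
  by (intro clinear_compose[OF clinear_tensor_lift] cbilinearI assms)

text \<open>
  Sweedler-style computations create many goals asking that an expression is linear in one of its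
  variables. These rules solve them by recursion on the expression; the collections \<open>lin\<close>, \<open>bilin\<close>,
  \<open>tlin\<close> and \<open>hlin\<close> below add the structure maps of a coalgebra, the product, the product of the
  tensor square and the antipode.
\<close>

lemmas clin = clinear_ident clinear_ident[folded id_def] clinear_plus clinear_scaleC clinear_scaleC_left
  clinear_times clinear_tensor clinear_tensor_lift_pointwise clinear_tensor_lift_compose

text \<open>
  \<open>tensor_lift f t\<close> is by definition a finite sum over a representative of \<open>t\<close>. This rule and the
  following ones exchange that sum with linear maps, other sums and limits.
\<close>

lemma linear_tensor_lift:
  assumes "clinear h"
  shows "h (tensor_lift f t) = tensor_lift (\<lambda>x y. h (f x y)) t"
  unfolding tensor_lift_def free_lift_def
  by (simp add: clinear_sum[OF assms] clinear_scale[OF assms] case_prod_unfold)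

lemma tensor_lift_sum:
  "tensor_lift (\<lambda>x y. \<Sum>i\<in>I. f i x y) t = (\<Sum>i\<in>I. tensor_lift (f i) t)"
  unfolding tensor_lift_def free_lift_def
  by (subst sum.swap) (simp add: cvec.scale_sum_right case_prod_unfold)

lemma tensor_lift_add:
  "tensor_lift (\<lambda>x y. f x y + g x y) t = tensor_lift f t + tensor_lift g t"
  unfolding tensor_lift_def free_lift_def
  by (simp add: scaleC_add_right case_prod_unfold sum.distrib)

lemma tensor_lift_sums:
  fixes f :: "nat \<Rightarrow> 'a::complex_vector \<Rightarrow> 'b::complex_vector \<Rightarrow> complex"
  assumes "\<And>x y. (\<lambda>n. f n x y) sums g x y"
  shows "(\<lambda>n. tensor_lift (f n) t) sums tensor_lift g t"
  unfolding tensor_lift_def free_lift_def case_prod_unfold scaleC_complex_def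
  by (intro sums_sum sums_mult assms)

lemma tensor_lift_tendsto:
  fixes f :: "'c \<Rightarrow> 'a::complex_vector \<Rightarrow> 'b::complex_vector \<Rightarrow> complex"
  assumes "\<And>x y. ((\<lambda>s. f s x y) \<longlongrightarrow> g x y) F"
  shows "((\<lambda>s. tensor_lift (f s) t) \<longlongrightarrow> tensor_lift g t) F"
  unfolding tensor_lift_def free_lift_def case_prod_unfold scaleC_complex_def
  by (intro tendsto_sum tendsto_mult tendsto_const assms)

lemma tensor_lift_swap:
  "tensor_lift (\<lambda>a b. tensor_lift (\<lambda>c d. f a b c d) s) t
    = tensor_lift (\<lambda>c d. tensor_lift (\<lambda>a b. f a b c d) t) s"
  unfolding tensor_lift_def free_lift_def case_prod_unfold cvec.scale_sum_right
  by (subst sum.swap) (simp add: scaleC_scaleC mult.commute)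

lemma tensor_ext:
  assumes "clinear f" "clinear g" "\<And>a b. f (a \<otimes> b) = g (a \<otimes> b)"
  shows "f t = g t"
proof -
  interpret vector_space_pair "scaleC :: complex \<Rightarrow> 'a \<otimes> 'b \<Rightarrow> _" "scaleC :: complex \<Rightarrow> 'c \<Rightarrow> _"
    by unfold_locales
  show ?thesis
    by (rule linear_eq_on_span[OF assms(1,2), of "{a \<otimes> b | a b. True}"])
      (use assms(3) span_tensors in auto)
qed

lemma tensor_lift_tensor_self: "tensor_lift (\<otimes>) t = t"
  by (rule tensor_ext[of _ "\<lambda>t. t"])
    (simp_all add: clinear_tensor_lift cbilinear_tensor tensor_lift_tensor clinear_ident)

lemma tensor_lift_tensor':
  assumes "\<And>a. clinear (\<lambda>b. f a b)" "\<And>b. clinear (\<lambda>a. f a b)"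
  shows "tensor_lift f (a \<otimes> b) = f a b"
  by (intro tensor_lift_tensor cbilinearI assms)

lemma clinear_tensor_map:
  assumes "clinear f" "clinear g"
  shows "clinear (tensor_map f g)"
  unfolding tensor_map_def by (intro clin assms clinear_compose[OF assms(1)] clinear_compose[OF assms(2)])

lemma tensor_map_tensor:
  assumes "clinear f" "clinear g"
  shows "tensor_map f g (a \<otimes> b) = f a \<otimes> g b"
  unfolding tensor_map_def by (intro tensor_lift_tensor' clin assms)

lemma tensor_lift_tensor_map:
  assumes "\<And>a. clinear (\<lambda>b. f a b)" "\<And>b. clinear (\<lambda>a. f a b)"
  shows "tensor_lift f (tensor_map g h t) = tensor_lift (\<lambda>x y. f (g x) (h y)) t"
proof -
  have "clinear (tensor_lift f)" by (intro clinear_tensor_lift cbilinearI assms)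
  then show ?thesis
    unfolding tensor_map_def by (subst linear_tensor_lift) (simp_all add: tensor_lift_tensor'[OF assms])
qed

lemma clinear_tensor_mult:
  assumes "clinear m" "clinear m'"
  shows "clinear (tensor_mult m m')"
  unfolding tensor_mult_def comp_def tensor_middle_swap_def
  by (intro clinear_compose[OF clinear_tensor_map[OF assms]] clin)

lemma tensor_mult_tensor:
  assumes "clinear m" "clinear m'"
  shows "tensor_mult m m' ((a \<otimes> b) \<otimes> (c \<otimes> d)) = m (a \<otimes> c) \<otimes> m' (b \<otimes> d)"
  unfolding tensor_mult_def comp_def tensor_middle_swap_def
  by (subst tensor_lift_tensor', (intro clin)+)+ (simp add: tensor_map_tensor assms)

lemma tensor_mult_tensor_map:
  assumes "clinear m" "clinear n" "clinear f" and "clinear m'" "clinear n'" "clinear g"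
    and "\<And>a b. n (f a \<otimes> f b) = f (m (a \<otimes> b))" "\<And>a b. n' (g a \<otimes> g b) = g (m' (a \<otimes> b))"
  shows "tensor_mult n n' (tensor_map f g x \<otimes> tensor_map f g y)
    = tensor_map f g (tensor_mult m m' (x \<otimes> y))"
proof -
  note l = clinear_tensor_map[OF assms(3,6)]
  note lin = clin clinear_compose[OF l] clinear_compose[OF clinear_tensor_mult[OF assms(1,4)]]
    clinear_compose[OF clinear_tensor_mult[OF assms(2,5)]]
  have *: "tensor_mult n n' (tensor_map f g (a \<otimes> b) \<otimes> tensor_map f g y)
    = tensor_map f g (tensor_mult m m' ((a \<otimes> b) \<otimes> y))" for a b
    by (rule tensor_ext[where t = y], (intro lin)+)
      (simp add: tensor_map_tensor tensor_mult_tensor assms)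
  show ?thesis by (rule tensor_ext[where t = x], (intro lin)+) (rule *)
qed

text \<open>
  A general complex vector space has no topology. An identity with values in it that is obtained from
  a convergent series is therefore proved after applying linear functionals.
\<close>

lemma linear_functionals_separate:
  fixes x y :: "'a::complex_vector"
  assumes "\<And>f :: 'a \<Rightarrow> complex. clinear f \<Longrightarrow> f x = f y"
  shows "x = y"
proof (rule ccontr)
  assume "x \<noteq> y"
  interpret vector_space_pair "scaleC :: complex \<Rightarrow> 'a \<Rightarrow> _" "scaleC :: complex \<Rightarrow> complex \<Rightarrow> _"
    by unfold_locales
  have "cvec.independent {x - y}" using \<open>x \<noteq> y\<close> by simp
  from linear_independent_extend[OF this, of "\<lambda>_. 1"]
  obtain f :: "'a \<Rightarrow> complex" where f: "clinear f" "f (x - y) = 1" by auto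
  have "f x = f (x - y) + f y" using clinear_add[OF f(1), of "x - y" y] by simp
  with assms[OF f(1)] f(2) show False by simp
qed

section \<open>Growth of orbits in finite dimension\<close>

text \<open>
  Choose a basis \<open>B\<close> of the span of \<open>V\<close>. The iterates of \<open>T\<close> on \<open>B\<close> are given by powers of one
  finite matrix, and the sum of the absolute values of its entries serves as the rate \<open>R\<close>.
\<close>

lemma iterate_bound:
  fixes T :: "'a::complex_vector \<Rightarrow> 'a" and f :: "'a \<Rightarrow> complex"
  assumes "clinear f" "clinear T" "finite W" "V \<subseteq> cvec.span W"
    and inv: "\<And>v. v \<in> V \<Longrightarrow> T v \<in> V" and "v \<in> V"
  obtains C R where "\<And>n. cmod (f ((T ^^ n) v)) \<le> C * R ^ n"
proof -
  obtain B where B: "B \<subseteq> V" "cvec.independent B" "V \<subseteq> cvec.span B"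
    using cvec.maximal_independent_subset[of V] by blast
  have fin: "finite B"
    using cvec.independent_span_bound[OF \<open>finite W\<close> B(2)] B(1) assms(4) by blast
  have rep: "\<exists>r. u = (\<Sum>b\<in>B. r b *\<^sub>C b)" if "u \<in> V" for u
    using B(3) that cvec.span_finite[OF fin] by auto
  have "\<forall>b\<in>B. \<exists>r. T b = (\<Sum>c\<in>B. r c *\<^sub>C c)" using rep inv B(1) by blast
  then obtain m where m: "\<And>b. b \<in> B \<Longrightarrow> T b = (\<Sum>c\<in>B. m b c *\<^sub>C c)" by metis
  obtain r where r: "v = (\<Sum>b\<in>B. r b *\<^sub>C b)" using rep[OF \<open>v \<in> V\<close>] by blast
  have lin: "clinear (\<lambda>x. f ((T ^^ n) x))" for n
  proof (induction n)
    case (Suc n)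
    from clinear_compose[OF Suc assms(2)] show ?case by (simp add: funpow_swap1)
  qed (simp add: assms(1))
  have comb: "f ((T ^^ n) (\<Sum>b\<in>B. c b *\<^sub>C b)) = (\<Sum>b\<in>B. c b * f ((T ^^ n) b))" for n c
    by (simp add: clinear_sum[OF lin] clinear_scale[OF lin] scaleC_complex_def)
  define F where "F n = (\<Sum>b\<in>B. cmod (f ((T ^^ n) b)))" for n
  define R where "R = (\<Sum>b\<in>B. \<Sum>c\<in>B. cmod (m b c))"
  have le: "cmod (f ((T ^^ n) (\<Sum>b\<in>B. c b *\<^sub>C b))) \<le> (\<Sum>b\<in>B. cmod (c b)) * F n" for n c
  proof -
    have "cmod (f ((T ^^ n) (\<Sum>b\<in>B. c b *\<^sub>C b))) \<le> (\<Sum>b\<in>B. cmod (c b) * cmod (f ((T ^^ n) b)))"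
      unfolding comb by (rule order_trans[OF norm_sum]) (simp add: norm_mult)
    also have "\<dots> \<le> (\<Sum>b\<in>B. cmod (c b) * F n)"
      unfolding F_def by (intro sum_mono mult_left_mono member_le_sum fin) auto
    finally show ?thesis by (simp add: sum_distrib_right)
  qed
  have "F n \<le> F 0 * R ^ n" for n
  proof (induction n)
    case (Suc n)
    have "F (Suc n) = (\<Sum>b\<in>B. cmod (f ((T ^^ n) (\<Sum>c\<in>B. m b c *\<^sub>C c))))"
      by (simp add: F_def funpow_swap1 m)
    also have "\<dots> \<le> (\<Sum>b\<in>B. (\<Sum>c\<in>B. cmod (m b c)) * F n)" by (intro sum_mono le)
    also have "\<dots> = R * F n" by (simp add: R_def sum_distrib_right)
    also have "\<dots> \<le> R * (F 0 * R ^ n)"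
      by (intro mult_left_mono Suc) (simp add: R_def sum_nonneg)
    finally show ?case by (simp add: mult_ac)
  qed simp
  then have "cmod (f ((T ^^ n) v)) \<le> ((\<Sum>b\<in>B. cmod (r b)) * F 0) * R ^ n" for n
    using order_trans[OF le[of n r] mult_left_mono[of "F n" "F 0 * R ^ n" "\<Sum>b\<in>B. cmod (r b)"]]
    by (simp add: r sum_nonneg mult.assoc)
  then show ?thesis by (rule that)
qed

section \<open>Sweedler calculus and convolution\<close>

text \<open>
  The Sweedler expression \<open>f(a\<^sub>1, a\<^sub>2)\<close> is rendered as \<open>tensor_lift f (comult a)\<close>.
\<close>

lemma (in coalgebra) sweedler_counit_left:
  assumes "clinear g"
  shows "tensor_lift (\<lambda>x y. counit x *\<^sub>C g y) (comult a) = g a"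
  using linear_tensor_lift[OF assms, of "\<lambda>x y. counit x *\<^sub>C y" "comult a"]
  by (simp add: counit_left clinear_scale[OF assms])

lemma (in coalgebra) sweedler_counit_right:
  assumes "clinear g"
  shows "tensor_lift (\<lambda>x y. counit y *\<^sub>C g x) (comult a) = g a"
  using linear_tensor_lift[OF assms, of "\<lambda>x y. counit y *\<^sub>C x" "comult a"]
  by (simp add: counit_right clinear_scale[OF assms])

text \<open>
  Both sides are the image under the linear map \<open>G\<close> induced by \<open>g\<close> on the triple tensor product of
  one side of the coassociativity axiom.
\<close>

lemma (in coalgebra) sweedler_coassoc:
  fixes g :: "'a \<Rightarrow> 'a \<Rightarrow> 'a \<Rightarrow> 'b::complex_vector"
  assumes g: "\<And>x y. clinear (\<lambda>z. g x y z)" "\<And>x z. clinear (\<lambda>y. g x y z)" "\<And>y z. clinear (\<lambda>x. g x y z)"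
  shows "tensor_lift (\<lambda>w z. tensor_lift (\<lambda>x y. g x y z) (comult w)) (comult a)
    = tensor_lift (\<lambda>x w. tensor_lift (\<lambda>y z. g x y z) (comult w)) (comult a)"
proof -
  define G where "G = tensor_lift (\<lambda>x w. tensor_lift (\<lambda>y z. g x y z) w)"
  have G: "clinear G" unfolding G_def by (intro clin g)
  have G_tensor: "G (x \<otimes> w) = tensor_lift (\<lambda>y z. g x y z) w" for x w
    unfolding G_def by (subst tensor_lift_tensor', (intro clin g)+) (rule refl)
  have assoc: "clinear (tensor_assoc :: ('a \<otimes> 'a) \<otimes> 'a \<Rightarrow> _)"
    unfolding tensor_assoc_def by (intro clin)
  have assoc_tensor: "tensor_assoc (w \<otimes> z) = tensor_lift (\<lambda>x y. x \<otimes> (y \<otimes> z)) w" for w :: "'a \<otimes> 'a" and z :: 'a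
    unfolding tensor_assoc_def by (subst tensor_lift_tensor', (intro clin)+) (rule refl)
  have G_assoc: "G (tensor_assoc (w \<otimes> z)) = tensor_lift (\<lambda>x y. g x y z) w" for w z
    unfolding assoc_tensor linear_tensor_lift[OF G] G_tensor
    by (subst tensor_lift_tensor', (intro clin g)+) (rule refl)
  have "tensor_lift (\<lambda>w z. tensor_lift (\<lambda>x y. g x y z) (comult w)) (comult a)
    = G (tensor_assoc (tensor_map comult id (comult a)))"
    by (simp add: tensor_map_def linear_tensor_lift[OF assoc] linear_tensor_lift[OF G] G_assoc)
  also have "\<dots> = G (tensor_map id comult (comult a))" by (simp add: coassoc)
  also have "\<dots> = tensor_lift (\<lambda>x w. tensor_lift (\<lambda>y z. g x y z) (comult w)) (comult a)"
    by (simp add: tensor_map_def linear_tensor_lift[OF G] G_tensor)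
  finally show ?thesis .
qed

context coalgebra
begin

lemmas lin = clin clinear_compose[OF comult_linear] clinear_compose[OF counit_linear]

lemma clinear_conv_fun:
  assumes "clinear f" "clinear g"
  shows "clinear (conv_fun comult f g)"
  unfolding conv_fun_def by (intro lin assms)

lemma clinear_conv_right:
  assumes "clinear f" "clinear g"
  shows "clinear (conv_right comult f g)"
  unfolding conv_right_def by (intro lin assms)

lemma clinear_conv_power: "clinear f \<Longrightarrow> clinear (conv_power comult counit f n)"
  by (induction n) (simp_all add: counit_linear clinear_conv_fun)

lemma conv_fun_assoc:
  assumes "clinear f" "clinear g" "clinear h"
  shows "conv_fun comult (conv_fun comult f g) h = conv_fun comult f (conv_fun comult g h)"
proof
  fix a
  have "conv_fun comult (conv_fun comult f g) h a
    = tensor_lift (\<lambda>w z. tensor_lift (\<lambda>x y. f x * g y * h z) (comult w)) (comult a)"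
    unfolding conv_fun_def by (subst linear_tensor_lift, intro clin) (rule refl)
  also have "\<dots> = tensor_lift (\<lambda>x w. tensor_lift (\<lambda>y z. f x * g y * h z) (comult w)) (comult a)"
    by (intro sweedler_coassoc lin assms)
  also have "\<dots> = conv_fun comult f (conv_fun comult g h) a"
    unfolding conv_fun_def mult.assoc by (subst linear_tensor_lift, intro clin) (rule refl)
  finally show "conv_fun comult (conv_fun comult f g) h a = conv_fun comult f (conv_fun comult g h) a" .
qed

lemma conv_right_assoc:
  assumes "clinear T" "clinear g" "clinear h"
  shows "conv_right comult (conv_right comult T g) h = conv_right comult T (conv_fun comult g h)"
proof
  fix a
  have "conv_right comult (conv_right comult T g) h a
    = tensor_lift (\<lambda>w z. tensor_lift (\<lambda>x y. h z *\<^sub>C g y *\<^sub>C T x) (comult w)) (comult a)"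
    unfolding conv_right_def by (subst linear_tensor_lift, intro clin) (rule refl)
  also have "\<dots> = tensor_lift (\<lambda>x w. tensor_lift (\<lambda>y z. h z *\<^sub>C g y *\<^sub>C T x) (comult w)) (comult a)"
    by (intro sweedler_coassoc lin assms)
  also have "\<dots> = conv_right comult T (conv_fun comult g h) a"
    unfolding conv_right_def conv_fun_def
    by (subst linear_tensor_lift[where h = "\<lambda>c. c *\<^sub>C v" for v], intro clin)
      (simp add: scaleC_scaleC mult.commute)
  finally show "conv_right comult (conv_right comult T g) h a = conv_right comult T (conv_fun comult g h) a" .
qed

lemma conv_fun_counit_left:
  assumes "clinear f"
  shows "conv_fun comult counit f = f"
  using sweedler_counit_left[OF assms] by (auto simp: conv_fun_def scaleC_complex_def)

lemma conv_fun_counit_right: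
  assumes "clinear f"
  shows "conv_fun comult f counit = f"
  using sweedler_counit_right[OF assms] by (auto simp: conv_fun_def scaleC_complex_def mult.commute)

lemma conv_right_counit:
  assumes "clinear T"
  shows "conv_right comult T counit = T"
  using sweedler_counit_right[OF assms] by (auto simp: conv_right_def)

lemma comult_conv_right_id:
  assumes "clinear e"
  shows "comult (conv_right comult id e a) = tensor_map id (conv_right comult id e) (comult a)"
proof -
  have "comult (conv_right comult id e a)
    = tensor_lift (\<lambda>w z. tensor_lift (\<lambda>x y. e z *\<^sub>C (x \<otimes> y)) (comult w)) (comult a)"
    unfolding conv_right_def linear_tensor_lift[OF comult_linear]
    by (subst linear_tensor_lift[where f = "(\<otimes>)" and h = "\<lambda>v. e _ *\<^sub>C v", symmetric], intro clin)
      (simp add: clinear_scale[OF comult_linear] tensor_lift_tensor_self)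
  also have "\<dots> = tensor_lift (\<lambda>x w. tensor_lift (\<lambda>y z. e z *\<^sub>C (x \<otimes> y)) (comult w)) (comult a)"
    by (intro sweedler_coassoc lin assms)
  also have "\<dots> = tensor_map id (conv_right comult id e) (comult a)"
    unfolding conv_right_def tensor_map_def
    by (subst linear_tensor_lift[where h = "\<lambda>v. _ \<otimes> v"], intro clin)
      (simp add: clinear_scale[OF clinear_tensor(2)[OF clinear_ident]])
  finally show ?thesis .
qed

lemma comult_conv_left_id:
  assumes "clinear e"
  shows "comult (conv_left comult e id a) = tensor_map (conv_left comult e id) id (comult a)"
proof -
  have "tensor_map (conv_left comult e id) id (comult a)
    = tensor_lift (\<lambda>w z. tensor_lift (\<lambda>x y. e x *\<^sub>C (y \<otimes> z)) (comult w)) (comult a)"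
    unfolding conv_left_def tensor_map_def
    by (subst linear_tensor_lift[where h = "\<lambda>v. v \<otimes> _"], intro clin)
      (simp add: clinear_scale[OF clinear_tensor(1)[OF clinear_ident]])
  also have "\<dots> = tensor_lift (\<lambda>x w. tensor_lift (\<lambda>y z. e x *\<^sub>C (y \<otimes> z)) (comult w)) (comult a)"
    by (intro sweedler_coassoc lin assms)
  also have "\<dots> = comult (conv_left comult e id a)"
    unfolding conv_left_def linear_tensor_lift[OF comult_linear]
    by (subst linear_tensor_lift[where f = "(\<otimes>)" and h = "\<lambda>v. e _ *\<^sub>C v", symmetric], intro clin)
      (simp add: clinear_scale[OF comult_linear] tensor_lift_tensor_self)
  finally show ?thesis ..
qed

section \<open>The convolution exponential\<close>

text \<open>
  Convolution by \<open>f\<close> on the left is dual to the operator \<open>T(b) = f(b\<^sub>1) b\<^sub>2\<close>, so the \<open>n\<close>-th power of \<open>f\<close>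
  is \<open>\<delta> \<circ> T\<^sup>n\<close>. The elements \<open>g(a\<^sub>1) a\<^sub>2\<close>, with \<open>g\<close> a functional, form a set that contains
  \<open>a\<close> (take \<open>g = \<delta>\<close>), is stable under \<open>T\<close> (which replaces \<open>g\<close> by \<open>g \<star> f\<close>) and lies in the span of
  the finitely many right legs of \<open>\<Delta>(a)\<close>.
\<close>

lemma conv_power_bound:
  assumes "clinear f"
  obtains C R where "\<And>n. cmod (conv_power comult counit f n a) \<le> C * R ^ n"
proof -
  define T where "T = conv_left comult f id"
  have T: "clinear T" unfolding T_def conv_left_def by (intro lin assms)
  have conv_fun_T: "conv_fun comult f g b = g (T b)" if "clinear g" for g b
    by (simp add: T_def conv_left_def conv_fun_def linear_tensor_lift[OF that] clinear_scale[OF that]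
        scaleC_complex_def)
  have power: "conv_power comult counit f n b = counit ((T ^^ n) b)" for n b
  proof (induction n arbitrary: b)
    case (Suc n)
    then show ?case
      by (simp add: conv_fun_T clinear_conv_power assms funpow_swap1)
  qed simp
  define V where "V = {tensor_lift (\<lambda>x y. g x *\<^sub>C y) (comult a) | g. clinear g}"
  define W where "W = snd ` Poly_Mapping.keys (rep_tensor (comult a))"
  have VI: "u \<in> V" if "clinear g" "u = tensor_lift (\<lambda>x y. g x *\<^sub>C y) (comult a)" for u g
    unfolding V_def using that by (intro CollectI exI[of _ g]) simp
  have "finite W" by (simp add: W_def)
  moreover have "V \<subseteq> cvec.span W"
    unfolding V_def W_def tensor_lift_def free_lift_def case_prod_unfold
    by (safe, intro cvec.span_sum cvec.span_scale cvec.span_base imageI)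
  moreover have "T v \<in> V" if "v \<in> V" for v
  proof -
    from that obtain g where g: "clinear g" "v = tensor_lift (\<lambda>x y. g x *\<^sub>C y) (comult a)"
      unfolding V_def by auto
    have "T v = tensor_lift (\<lambda>x w. tensor_lift (\<lambda>y z. g x *\<^sub>C f y *\<^sub>C z) (comult w)) (comult a)"
      unfolding g(2) linear_tensor_lift[OF T] clinear_scale[OF T]
      unfolding T_def conv_left_def id_apply
      by (subst linear_tensor_lift[where h = "\<lambda>v. c *\<^sub>C v" for c], intro clin) (rule refl)
    also have "\<dots> = tensor_lift (\<lambda>w z. tensor_lift (\<lambda>x y. g x *\<^sub>C f y *\<^sub>C z) (comult w)) (comult a)"
      by (intro sweedler_coassoc[symmetric] lin g assms)
    also have "\<dots> = tensor_lift (\<lambda>w z. conv_fun comult g f w *\<^sub>C z) (comult a)"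
      unfolding conv_fun_def
      by (subst linear_tensor_lift[where h = "\<lambda>c. c *\<^sub>C v" for v], intro clin) (simp add: scaleC_scaleC)
    finally show ?thesis by (rule VI[OF clinear_conv_fun[OF g(1) assms]])
  qed
  moreover have "a \<in> V" by (rule VI[OF counit_linear]) (simp add: counit_left)
  ultimately show ?thesis
    using iterate_bound[OF counit_linear T, of W V a] that by (auto simp: power)
qed

lemma conv_exp_summable:
  assumes "clinear f"
  shows "summable (\<lambda>n. cmod (conv_power comult counit f n a / fact n))"
proof -
  obtain C R where b: "\<And>n. cmod (conv_power comult counit f n a) \<le> C * R ^ n"
    using conv_power_bound[OF assms] by blast
  have "summable (\<lambda>n. C * (R ^ n / fact n))"
    using summable_exp[of R] by (intro summable_mult) (simp add: divide_inverse mult.commute)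
  then show ?thesis
    by (rule summable_comparison_test[rotated])
      (use b in \<open>auto simp: norm_divide divide_right_mono\<close>)
qed

lemma conv_exp_sums:
  assumes "clinear f"
  shows "(\<lambda>n. conv_power comult counit f n a / fact n) sums conv_exp comult counit f a"
  unfolding conv_exp_def
  by (rule summable_sums[OF summable_norm_cancel[OF conv_exp_summable[OF assms]]])

lemma clinear_conv_exp:
  assumes "clinear f"
  shows "clinear (conv_exp comult counit f)"
proof (rule clinearI)
  note P = clinear_conv_power[OF assms]
  fix x y c
  have "(\<lambda>n. conv_power comult counit f n (x + y) / fact n) sums
    (conv_exp comult counit f x + conv_exp comult counit f y)"
    using sums_add[OF conv_exp_sums[OF assms] conv_exp_sums[OF assms]]
    by (simp add: clinear_add[OF P] add_divide_distrib)
  then show "conv_exp comult counit f (x + y) = conv_exp comult counit f x + conv_exp comult counit f y"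
    by (rule sums_unique2[OF conv_exp_sums[OF assms]])
  have "(\<lambda>n. conv_power comult counit f n (c *\<^sub>C x) / fact n) sums (c *\<^sub>C conv_exp comult counit f x)"
    using sums_mult[OF conv_exp_sums[OF assms], of c] by (simp add: clinear_scale[OF P] scaleC_complex_def)
  then show "conv_exp comult counit f (c *\<^sub>C x) = c *\<^sub>C conv_exp comult counit f x"
    by (rule sums_unique2[OF conv_exp_sums[OF assms]])
qed

lemma conv_fun_add_left: "conv_fun comult (\<lambda>a. f a + g a) h a = conv_fun comult f h a + conv_fun comult g h a"
  unfolding conv_fun_def by (simp add: tensor_lift_add[symmetric] distrib_right)

lemma conv_fun_sum_right: "conv_fun comult f (\<lambda>a. \<Sum>i\<in>I. g i a) a = (\<Sum>i\<in>I. conv_fun comult f (g i) a)"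
  unfolding conv_fun_def by (simp add: tensor_lift_sum[symmetric] sum_distrib_left)

lemma conv_fun_scale:
  "conv_fun comult (\<lambda>a. c * f a) g a = c * conv_fun comult f g a"
  "conv_fun comult f (\<lambda>a. c * g a) a = c * conv_fun comult f g a"
  unfolding conv_fun_def
  by (subst linear_tensor_lift, (intro clin)+, simp add: mult_ac)+

lemma conv_fun_divide:
  "conv_fun comult (\<lambda>a. f a / c) g a = conv_fun comult f g a / c"
  "conv_fun comult f (\<lambda>a. g a / c) a = conv_fun comult f g a / c"
  using conv_fun_scale(1)[of "inverse c" f g a] conv_fun_scale(2)[of f "inverse c" g a]
  by (simp_all add: divide_inverse mult.commute)

lemma conv_power_commute:
  assumes "clinear f" "clinear g" "conv_fun comult f g = conv_fun comult g f"
  shows "conv_fun comult (conv_power comult counit f n) g = conv_fun comult g (conv_power comult counit f n)"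
proof (induction n)
  case 0
  show ?case by (simp add: conv_fun_counit_left conv_fun_counit_right assms)
next
  case (Suc n)
  then show ?case
    using assms by (simp add: conv_fun_assoc clinear_conv_power)
      (simp add: conv_fun_assoc[symmetric] clinear_conv_power)
qed

text \<open>
  The binomial theorem for convolution. With the factorials divided out, left convolution by \<open>f\<close> or
  by \<open>g\<close> raises one index of \<open>Q i j = f\<^sup>i/i! \<star> g\<^sup>j/j!\<close> and multiplies by the new index; the two
  multipliers add up to \<open>n + 1\<close>.
\<close>

lemma conv_power_add:
  assumes f: "clinear f" and g: "clinear g" and comm: "conv_fun comult f g = conv_fun comult g f"
  shows "conv_power comult counit (\<lambda>a. f a + g a) n a / fact n
    = (\<Sum>i\<le>n. conv_fun comult (\<lambda>a. conv_power comult counit f i a / fact i)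
        (\<lambda>a. conv_power comult counit g (n - i) a / fact (n - i)) a)"
proof -
  define P where "P h n a = conv_power comult counit h n a / fact n" for h :: "'a \<Rightarrow> complex" and n a
  have P: "clinear (P h n)" if "clinear h" for h n
    unfolding P_def divide_inverse by (intro clin clinear_conv_power that)
  have P_Suc: "conv_fun comult h (P h n) a = of_nat (Suc n) * P h (Suc n) a" for h n a
    by (simp add: P_def[abs_def] conv_fun_divide del: of_nat_Suc)
  have P_comm: "conv_fun comult (P f i) g = conv_fun comult g (P f i)" for i
    using conv_power_commute[OF assms] by (auto simp: P_def[abs_def] conv_fun_divide)
  define Q where "Q i j = conv_fun comult (P f i) (P g j)" for i j
  have Qf: "conv_fun comult f (Q i j) a = of_nat (Suc i) * Q (Suc i) j a" for i j a
  proof -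
    have "conv_fun comult f (Q i j) = conv_fun comult (conv_fun comult f (P f i)) (P g j)"
      unfolding Q_def by (intro conv_fun_assoc[symmetric] f g P)
    then show ?thesis by (simp add: P_Suc[abs_def] conv_fun_scale Q_def del: of_nat_Suc)
  qed
  have Qg: "conv_fun comult g (Q i j) a = of_nat (Suc j) * Q i (Suc j) a" for i j a
  proof -
    have "conv_fun comult g (Q i j) = conv_fun comult (conv_fun comult g (P f i)) (P g j)"
      unfolding Q_def by (intro conv_fun_assoc[symmetric] f g P)
    also have "\<dots> = conv_fun comult (P f i) (conv_fun comult g (P g j))"
      unfolding P_comm[symmetric] by (intro conv_fun_assoc f g P)
    finally show ?thesis by (simp add: P_Suc[abs_def] conv_fun_scale Q_def del: of_nat_Suc)
  qed
  have "P (\<lambda>a. f a + g a) n a = (\<Sum>i\<le>n. Q i (n - i) a)" for a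
  proof (induction n arbitrary: a)
    case 0
    show ?case by (simp add: P_def[abs_def] Q_def conv_fun_counit_left counit_linear)
  next
    case (Suc n)
    have "of_nat (Suc n) * P (\<lambda>a. f a + g a) (Suc n) a
      = (\<Sum>i\<le>n. conv_fun comult f (Q i (n - i)) a) + (\<Sum>i\<le>n. conv_fun comult g (Q i (n - i)) a)"
      unfolding P_Suc[symmetric] Suc[abs_def] conv_fun_add_left conv_fun_sum_right ..
    also have "(\<Sum>i\<le>n. conv_fun comult f (Q i (n - i)) a) = (\<Sum>i\<le>Suc n. of_nat i * Q i (Suc n - i) a)"
      unfolding Qf by (subst sum.atMost_Suc_shift) simp
    also have "(\<Sum>i\<le>n. conv_fun comult g (Q i (n - i)) a)
      = (\<Sum>i\<le>Suc n. of_nat (Suc n - i) * Q i (Suc n - i) a)"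
      unfolding Qg by (simp add: Suc_diff_le add_diff_eq)
    also have "(\<Sum>i\<le>Suc n. of_nat i * Q i (Suc n - i) a) + (\<Sum>i\<le>Suc n. of_nat (Suc n - i) * Q i (Suc n - i) a)
      = (\<Sum>i\<le>Suc n. of_nat (Suc n) * Q i (Suc n - i) a)"
      unfolding sum.distrib[symmetric] distrib_right[symmetric] of_nat_add[symmetric]
      by (intro sum.cong) simp_all
    finally have "of_nat (Suc n) * P (\<lambda>a. f a + g a) (Suc n) a
      = of_nat (Suc n) * (\<Sum>i\<le>Suc n. Q i (Suc n - i) a)"
      unfolding sum_distrib_left .
    then show ?case by (simp del: of_nat_Suc sum.atMost_Suc)
  qed
  then show ?thesis by (simp add: P_def[abs_def] Q_def)
qed

lemma conv_exp_add:
  assumes f: "clinear f" and g: "clinear g" and comm: "conv_fun comult f g = conv_fun comult g f"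
  shows "conv_fun comult (conv_exp comult counit f) (conv_exp comult counit g)
    = conv_exp comult counit (\<lambda>a. f a + g a)"
proof
  fix a
  let ?P = "\<lambda>h n a. conv_power comult counit h n a / fact n"
  have "(\<lambda>n. \<Sum>i\<le>n. ?P f i x * ?P g (n - i) y) sums
    (conv_exp comult counit f x * conv_exp comult counit g y)" for x y
    using Cauchy_product_sums[OF conv_exp_summable[OF f] conv_exp_summable[OF g]]
    by (simp add: conv_exp_def)
  then have "(\<lambda>n. tensor_lift (\<lambda>x y. \<Sum>i\<le>n. ?P f i x * ?P g (n - i) y) (comult a)) sums
    tensor_lift (\<lambda>x y. conv_exp comult counit f x * conv_exp comult counit g y) (comult a)"
    by (rule tensor_lift_sums)
  then have "(\<lambda>n. ?P (\<lambda>a. f a + g a) n a) sums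
    conv_fun comult (conv_exp comult counit f) (conv_exp comult counit g) a"
    unfolding conv_power_add[OF assms] by (simp add: tensor_lift_sum conv_fun_def)
  then show "conv_fun comult (conv_exp comult counit f) (conv_exp comult counit g) a
    = conv_exp comult counit (\<lambda>a. f a + g a) a"
    by (rule sums_unique2[OF _ conv_exp_sums[OF clinear_plus[OF f g]]])
qed

lemma conv_power_scale: "conv_power comult counit (\<lambda>a. c * f a) n a = c ^ n * conv_power comult counit f n a"
proof (induction n arbitrary: a)
  case (Suc n)
  then have "conv_power comult counit (\<lambda>a. c * f a) n = (\<lambda>a. c ^ n * conv_power comult counit f n a)" by blast
  then show ?case by (simp add: conv_fun_scale)
qed simp

lemma conv_exp_zero: "conv_exp comult counit (\<lambda>_. 0) = counit"
proof
  fix a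
  have "conv_power comult counit (\<lambda>_. 0) n a = 0" if "n \<noteq> 0" for n
    using that by (cases n) (simp_all add: conv_fun_def tensor_lift_def free_lift_def)
  then show "conv_exp comult counit (\<lambda>_. 0) a = counit a"
    unfolding conv_exp_def by (subst suminf_finite[of "{0}"]) auto
qed

text \<open>At a fixed element, the exponential of \<open>z f\<close> is an everywhere convergent power series in \<open>z\<close>.\<close>

lemma conv_exp_tendsto:
  fixes c :: real
  assumes "clinear f"
  shows "((\<lambda>t. conv_exp comult counit (\<lambda>a. complex_of_real (c * t) * f a) a) \<longlongrightarrow> counit a) (at 0)"
proof -
  let ?E = "\<lambda>z. conv_exp comult counit (\<lambda>a. z * f a) a"
  have "(\<lambda>n. (conv_power comult counit f n a / fact n) * z ^ n) sums ?E z" for z :: complex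
    using conv_exp_sums[OF clinear_times(1)[OF assms], of z a] by (simp add: conv_power_scale mult.commute)
  then have "(?E \<longlongrightarrow> counit a) (at 0)"
    using powser_limit_0[of 1 "\<lambda>n. conv_power comult counit f n a / fact n" ?E] by simp
  moreover have "?E 0 = counit a" by (simp add: conv_exp_zero)
  ultimately have "isCont ?E 0" by (simp add: isCont_def)
  moreover have "((\<lambda>t. complex_of_real (c * t)) \<longlongrightarrow> 0) (at 0)"
    by (auto intro!: tendsto_eq_intros)
  ultimately show ?thesis
    using isCont_tendsto_compose[of 0 ?E "\<lambda>t. complex_of_real (c * t)" "at 0"] by (simp add: conv_exp_zero)
qed

text \<open>
  Applying a functional \<open>f\<close> to \<open>e \<star> id\<close> and \<open>id \<star> e\<close> gives \<open>e \<star> f\<close> and \<open>f \<star> e\<close>. The condition on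
  functionals is the one that survives the passage to limits.
\<close>

lemma commuting_iff:
  assumes "clinear e"
  shows "commuting comult e \<longleftrightarrow> (\<forall>f. clinear f \<longrightarrow> conv_fun comult e f = conv_fun comult f e)"
proof -
  have l: "conv_fun comult e f a = f (conv_left comult e id a)" if "clinear f" for f a
    by (simp add: conv_fun_def conv_left_def linear_tensor_lift[OF that] clinear_scale[OF that] scaleC_complex_def)
  have r: "conv_fun comult f e a = f (conv_right comult id e a)" if "clinear f" for f a
    by (simp add: conv_fun_def conv_right_def linear_tensor_lift[OF that] clinear_scale[OF that]
        scaleC_complex_def mult.commute)
  show ?thesis
  proof
    assume "commuting comult e"
    then show "\<forall>f. clinear f \<longrightarrow> conv_fun comult e f = conv_fun comult f e"
      by (auto simp: commuting_def l r)
  next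
    assume "\<forall>f. clinear f \<longrightarrow> conv_fun comult e f = conv_fun comult f e"
    then show "commuting comult e"
      unfolding commuting_def using l r by (metis linear_functionals_separate ext)
  qed
qed

lemma commuting_conv_exp:
  assumes "clinear f" "commuting comult f"
  shows "commuting comult (conv_exp comult counit f)"
  unfolding commuting_iff[OF clinear_conv_exp[OF assms(1)]]
proof (intro allI impI ext)
  fix g :: "'a \<Rightarrow> complex" and a assume g: "clinear g"
  have "conv_fun comult f g = conv_fun comult g f" using assms g commuting_iff by blast
  note comm = conv_power_commute[OF assms(1) g this]
  have "(\<lambda>n. conv_fun comult (\<lambda>a. conv_power comult counit f n a / fact n) g a) sums
      conv_fun comult (conv_exp comult counit f) g a"
    unfolding conv_fun_def by (intro tensor_lift_sums sums_mult2 conv_exp_sums assms)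
  moreover have "(\<lambda>n. conv_fun comult g (\<lambda>a. conv_power comult counit f n a / fact n) a) sums
      conv_fun comult g (conv_exp comult counit f) a"
    unfolding conv_fun_def by (intro tensor_lift_sums sums_mult conv_exp_sums assms)
  moreover have "conv_fun comult (\<lambda>a. conv_power comult counit f n a / fact n) g a
      = conv_fun comult g (\<lambda>a. conv_power comult counit f n a / fact n) a" for n
    using comm[of n] by (simp add: conv_fun_divide)
  ultimately show "conv_fun comult (conv_exp comult counit f) g a = conv_fun comult g (conv_exp comult counit f) a"
    by (simp add: sums_unique2)
qed

end

section \<open>The antipode reverses the coproduct\<close>

context bialgebra
begin

(* Input only: the right-hand side applies a variable, so contracting it for output would match every map on a tensor. *)
abbreviation (input) product (infixl "\<cdot>" 70) where "a \<cdot> b \<equiv> mult (a \<otimes> b)"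

lemmas bilin = lin clinear_compose[OF mult_linear]

lemma counit_mult: "counit (a \<cdot> b) = counit a * counit b"
proof -
  have "counit (a \<cdot> b) = tensor_lift (*) (tensor_map counit counit (a \<otimes> b))"
    using counit_hom by (auto simp: algebra_hom_def dest!: fun_cong[where x = "a \<otimes> b"])
  also have "\<dots> = counit a * counit b"
    unfolding tensor_map_tensor[OF counit_linear counit_linear]
    by (rule tensor_lift_tensor') (rule clinear_times[OF clinear_ident])+
  finally show ?thesis .
qed

lemma counit_unit: "counit unit = 1"
  using counit_hom by (simp add: algebra_hom_def)

lemma comult_unit: "comult unit = unit \<otimes> unit"
  using comult_hom by (simp add: algebra_hom_def)

lemma conv_fun_unit:
  assumes "clinear f" "clinear g"
  shows "conv_fun comult f g unit = f unit * g unit"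
  unfolding conv_fun_def comult_unit by (intro tensor_lift_tensor' clinear_times assms)

lemma comult_mult: "comult (a \<cdot> b) = tensor_mult mult mult (comult a \<otimes> comult b)"
proof -
  have "comult (a \<cdot> b) = tensor_mult mult mult (tensor_map comult comult (a \<otimes> b))"
    using comult_hom by (auto simp: algebra_hom_def dest!: fun_cong[where x = "a \<otimes> b"])
  then show ?thesis by (simp add: tensor_map_tensor comult_linear)
qed

abbreviation (input) tensor_product (infixl "\<odot>" 70) where "p \<odot> q \<equiv> tensor_mult mult mult (p \<otimes> q)"

lemmas tlin = bilin clinear_compose[OF clinear_tensor_mult[OF mult_linear mult_linear]]

lemma tensor_product_tensor: "(a \<otimes> b) \<odot> (c \<otimes> d) = (a \<cdot> c) \<otimes> (b \<cdot> d)"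
  by (rule tensor_mult_tensor[OF mult_linear mult_linear])

lemma tensor_product_assoc: "p \<odot> q \<odot> r = p \<odot> (q \<odot> r)"
proof -
  have 1: "(a \<otimes> b) \<odot> (c \<otimes> d) \<odot> r = (a \<otimes> b) \<odot> ((c \<otimes> d) \<odot> r)" for a b c d
    by (rule tensor_ext[where t = r], (intro tlin)+) (simp add: tensor_product_tensor mult_assoc)
  have 2: "(a \<otimes> b) \<odot> q \<odot> r = (a \<otimes> b) \<odot> (q \<odot> r)" for a b
    by (rule tensor_ext[where t = q], (intro tlin)+) (rule 1)
  show ?thesis by (rule tensor_ext[where t = p], (intro tlin)+) (rule 2)
qed

lemma tensor_product_unit_left: "(unit \<otimes> unit) \<odot> p = p"
  by (rule tensor_ext[where t = p], (intro tlin)+) (simp add: tensor_product_tensor mult_unit_left)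

lemma tensor_product_unit_right: "p \<odot> (unit \<otimes> unit) = p"
  by (rule tensor_ext[where t = p], (intro tlin)+) (simp add: tensor_product_tensor mult_unit_right)

lemma tensor_product_scale:
  "(c *\<^sub>C p) \<odot> q = c *\<^sub>C (p \<odot> q)" "p \<odot> (c *\<^sub>C q) = c *\<^sub>C (p \<odot> q)"
proof -
  have "clinear (\<lambda>p. p \<odot> q)" "clinear (\<lambda>q. p \<odot> q)" by (intro tlin)+
  then show "(c *\<^sub>C p) \<odot> q = c *\<^sub>C (p \<odot> q)" "p \<odot> (c *\<^sub>C q) = c *\<^sub>C (p \<odot> q)"
    by (auto dest: clinear_scale)
qed

text \<open>
  A left inverse and a right inverse of \<open>D\<close> agree in the convolution algebra of maps from the coalgebra
  to its tensor square: \<open>X = X \<star> (D \<star> Y) = (X \<star> D) \<star> Y = Y\<close>.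
\<close>

lemma convolution_inverse_unique:
  assumes lin: "clinear X" "clinear D" "clinear Y"
    and XD: "\<And>a. tensor_lift (\<lambda>x y. X x \<odot> D y) (comult a) = counit a *\<^sub>C (unit \<otimes> unit)"
    and DY: "\<And>a. tensor_lift (\<lambda>x y. D x \<odot> Y y) (comult a) = counit a *\<^sub>C (unit \<otimes> unit)"
  shows "X a = Y a"
proof -
  note l = tlin clinear_compose[OF lin(1)] clinear_compose[OF lin(2)] clinear_compose[OF lin(3)]
  have "X a = tensor_lift (\<lambda>x w. X x \<odot> (counit w *\<^sub>C (unit \<otimes> unit))) (comult a)"
    by (simp add: tensor_product_scale tensor_product_unit_right sweedler_counit_right lin)
  also have "\<dots> = tensor_lift (\<lambda>x w. tensor_lift (\<lambda>y z. X x \<odot> (D y \<odot> Y z)) (comult w)) (comult a)"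
    unfolding DY[symmetric] by (subst linear_tensor_lift, intro l) (rule refl)
  also have "\<dots> = tensor_lift (\<lambda>w z. tensor_lift (\<lambda>x y. X x \<odot> (D y \<odot> Y z)) (comult w)) (comult a)"
    by (intro sweedler_coassoc[symmetric] l)
  also have "\<dots> = tensor_lift (\<lambda>w z. (counit w *\<^sub>C (unit \<otimes> unit)) \<odot> Y z) (comult a)"
    unfolding XD[symmetric] tensor_product_assoc[symmetric]
    by (subst linear_tensor_lift[where h = "\<lambda>p. p \<odot> q" for q], intro l) (rule refl)
  also have "\<dots> = Y a"
    by (simp add: tensor_product_scale tensor_product_unit_left sweedler_counit_left lin)
  finally show ?thesis .
qed

end

context hopf_algebra
begin

lemmas hlin = tlin clinear_compose[OF antipode_linear]

lemma sweedler_antipode_left: "tensor_lift (\<lambda>x y. antipode x \<cdot> y) (comult a) = counit a *\<^sub>C unit"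
  using antipode_left[of a] by (simp add: tensor_map_def linear_tensor_lift[OF mult_linear])

lemma sweedler_antipode_right: "tensor_lift (\<lambda>x y. x \<cdot> antipode y) (comult a) = counit a *\<^sub>C unit"
  using antipode_right[of a] by (simp add: tensor_map_def linear_tensor_lift[OF mult_linear])

text \<open>
  Both sides are convolution inverses of \<open>\<Delta>\<close>: the left one since \<open>\<Delta>\<close> is multiplicative, the right one
  since \<open>a\<^sub>1 S(a\<^sub>4) \<otimes> a\<^sub>2 S(a\<^sub>3)\<close> collapses from the inside.
\<close>

lemma comult_antipode: "comult (antipode a) = tensor_lift (\<lambda>x y. antipode y \<otimes> antipode x) (comult a)"
proof (rule convolution_inverse_unique[where D = comult and X = "\<lambda>a. comult (antipode a)"])
  show "clinear (\<lambda>a. comult (antipode a))"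
    "clinear (\<lambda>a. tensor_lift (\<lambda>x y. antipode y \<otimes> antipode x) (comult a))" "clinear comult"
    by (intro hlin comult_linear)+
  fix a
  have "tensor_lift (\<lambda>x y. comult (antipode x) \<odot> comult y) (comult a)
    = comult (tensor_lift (\<lambda>x y. antipode x \<cdot> y) (comult a))"
    by (simp add: linear_tensor_lift[OF comult_linear] comult_mult)
  also have "\<dots> = counit a *\<^sub>C (unit \<otimes> unit)"
    by (simp add: sweedler_antipode_left clinear_scale[OF comult_linear] comult_unit)
  finally show "tensor_lift (\<lambda>x y. comult (antipode x) \<odot> comult y) (comult a) = counit a *\<^sub>C (unit \<otimes> unit)" .
  have expand: "comult x \<odot> tensor_lift (\<lambda>u v. antipode v \<otimes> antipode u) (comult y)
    = tensor_lift (\<lambda>p q. tensor_lift (\<lambda>u v. (p \<cdot> antipode v) \<otimes> (q \<cdot> antipode u)) (comult y)) (comult x)" for x y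
  proof -
    have "comult x \<odot> tensor_lift (\<lambda>u v. antipode v \<otimes> antipode u) (comult y)
      = tensor_lift (\<lambda>p q. (p \<otimes> q) \<odot> tensor_lift (\<lambda>u v. antipode v \<otimes> antipode u) (comult y)) (comult x)"
      by (subst linear_tensor_lift[where h = "\<lambda>p. p \<odot> q" for q, symmetric], intro tlin)
        (simp add: tensor_lift_tensor_self)
    also have "\<dots> = tensor_lift (\<lambda>p q. tensor_lift (\<lambda>u v. (p \<otimes> q) \<odot> (antipode v \<otimes> antipode u)) (comult y)) (comult x)"
      by (subst linear_tensor_lift[where h = "\<lambda>q. p \<odot> q" for p], intro tlin) (rule refl)
    finally show ?thesis by (simp only: tensor_product_tensor)
  qed
  have cancel: "tensor_lift (\<lambda>q y. tensor_lift (\<lambda>u v. (p \<cdot> antipode v) \<otimes> (q \<cdot> antipode u)) (comult y)) (comult w)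
    = (p \<cdot> antipode w) \<otimes> unit" for p w
  proof -
    have "tensor_lift (\<lambda>q y. tensor_lift (\<lambda>u v. (p \<cdot> antipode v) \<otimes> (q \<cdot> antipode u)) (comult y)) (comult w)
      = tensor_lift (\<lambda>z v. tensor_lift (\<lambda>q u. (p \<cdot> antipode v) \<otimes> (q \<cdot> antipode u)) (comult z)) (comult w)"
      by (intro sweedler_coassoc[symmetric] hlin)
    also have "\<dots> = tensor_lift (\<lambda>z v. (p \<cdot> antipode v) \<otimes> (counit z *\<^sub>C unit)) (comult w)"
      unfolding sweedler_antipode_right[symmetric]
      by (subst linear_tensor_lift[where h = "\<lambda>b. a \<otimes> b" for a], intro tlin) (rule refl)
    also have "\<dots> = tensor_lift (\<lambda>z v. counit z *\<^sub>C ((p \<cdot> antipode v) \<otimes> unit)) (comult w)"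
      by (simp add: clinear_scale[OF clinear_tensor(2)[OF clinear_ident]])
    also have "\<dots> = (p \<cdot> antipode w) \<otimes> unit" by (intro sweedler_counit_left hlin)
    finally show ?thesis .
  qed
  have "tensor_lift (\<lambda>x y. comult x \<odot> tensor_lift (\<lambda>u v. antipode v \<otimes> antipode u) (comult y)) (comult a)
    = tensor_lift (\<lambda>p w. tensor_lift (\<lambda>q y. tensor_lift (\<lambda>u v. (p \<cdot> antipode v) \<otimes> (q \<cdot> antipode u)) (comult y)) (comult w)) (comult a)"
    unfolding expand by (intro sweedler_coassoc hlin)
  also have "\<dots> = tensor_lift (\<lambda>p w. p \<cdot> antipode w) (comult a) \<otimes> unit"
    unfolding cancel by (subst linear_tensor_lift[where h = "\<lambda>a. a \<otimes> unit"], intro tlin) (rule refl)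
  also have "\<dots> = counit a *\<^sub>C (unit \<otimes> unit)"
    by (simp add: sweedler_antipode_right clinear_scale[OF clinear_tensor(1)[OF clinear_ident]])
  finally show "tensor_lift (\<lambda>x y. comult x \<odot> tensor_lift (\<lambda>u v. antipode v \<otimes> antipode u) (comult y)) (comult a)
    = counit a *\<^sub>C (unit \<otimes> unit)" .
qed

lemma sweedler_antipode:
  assumes "\<And>a. clinear (\<lambda>b. f a b)" "\<And>b. clinear (\<lambda>a. f a b)"
  shows "tensor_lift f (comult (antipode a)) = tensor_lift (\<lambda>x y. f (antipode y) (antipode x)) (comult a)"
proof -
  have "clinear (tensor_lift f)" by (intro clinear_tensor_lift cbilinearI assms)
  then show ?thesis
    unfolding comult_antipode by (subst linear_tensor_lift) (simp_all add: tensor_lift_tensor'[OF assms])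
qed

lemma counit_antipode: "counit (antipode a) = counit a"
proof -
  have "counit (antipode a) = tensor_lift (\<lambda>x y. counit (antipode x) * counit y) (comult a)"
    using sweedler_counit_right[OF clinear_compose[OF counit_linear antipode_linear], of a]
    by (simp add: scaleC_complex_def mult.commute)
  also have "\<dots> = counit (tensor_lift (\<lambda>x y. antipode x \<cdot> y) (comult a))"
    by (simp add: linear_tensor_lift[OF counit_linear] counit_mult)
  also have "\<dots> = counit a"
    by (simp add: sweedler_antipode_left clinear_scale[OF counit_linear] counit_unit scaleC_complex_def)
  finally show ?thesis .
qed

text \<open>
  Precomposition with \<open>S\<close> reverses the order of a convolution product. The powers of a single
  functional commute, so the reversal disappears for powers and for the exponential.
\<close>

lemma conv_fun_antipode:
  assumes "clinear f" "clinear g"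
  shows "conv_fun comult f g (antipode a) = conv_fun comult (\<lambda>x. g (antipode x)) (\<lambda>x. f (antipode x)) a"
  unfolding conv_fun_def by (subst sweedler_antipode, (intro clin assms)+) (simp add: mult.commute)

lemma conv_power_antipode:
  assumes "clinear f"
  shows "conv_power comult counit f n (antipode a) = conv_power comult counit (\<lambda>x. f (antipode x)) n a"
proof (induction n arbitrary: a)
  case (Suc n)
  have f: "clinear (\<lambda>x. f (antipode x))" by (intro clinear_compose[OF assms] antipode_linear)
  show ?case
    by (simp add: conv_fun_antipode assms clinear_conv_power Suc conv_power_commute[OF f f])
qed (simp add: counit_antipode)

lemma conv_exp_antipode:
  assumes "clinear f"
  shows "conv_exp comult counit f (antipode a) = conv_exp comult counit (\<lambda>x. f (antipode x)) a"
  unfolding conv_exp_def by (simp add: conv_power_antipode assms)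

end

section \<open>The flow of a commuting functional\<close>

context coalgebra
begin

lemma linear_conv_right_id:
  assumes "clinear T"
  shows "T (conv_right comult id e a) = conv_right comult T e a"
  by (simp add: conv_right_def linear_tensor_lift[OF assms] clinear_scale[OF assms])

lemma commuting_scale:
  assumes "clinear f" "commuting comult f"
  shows "commuting comult (\<lambda>a. c * f a)"
  using assms(2) unfolding commuting_iff[OF assms(1)] commuting_iff[OF clinear_times(1)[OF assms(1)]]
  by (auto simp: conv_fun_scale)

end

locale commuting_functional = bialgebra mult unit comult counit
  for mult :: "'a::complex_vector \<otimes> 'a \<Rightarrow> 'a" and unit comult counit +
  fixes \<psi> :: "'a \<Rightarrow> complex"
  assumes psi_linear: "clinear \<psi>"
    and psi_commuting: "commuting comult \<psi>"
    and psi_normalized: "normalized unit \<psi>"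
begin

definition E :: "real \<Rightarrow> 'a \<Rightarrow> complex"
  where "E t = conv_exp comult counit (\<lambda>a. - complex_of_real t * \<psi> a)"

abbreviation "\<Phi> \<equiv> deformation_flow comult counit \<psi>"
abbreviation "M \<equiv> trivial_deformation mult comult counit \<psi>"

lemma clinear_E: "clinear (E t)"
  unfolding E_def by (intro clinear_conv_exp clin psi_linear)

lemma flow_conv_right: "\<Phi> t = conv_right comult id (E t)"
  by (simp add: deformation_flow_def E_def)

lemma flow_eq: "\<Phi> t a = tensor_lift (\<lambda>x y. E t y *\<^sub>C x) (comult a)"
  by (simp add: flow_conv_right conv_right_def)

lemma flow_eq_left: "\<Phi> t a = tensor_lift (\<lambda>x y. E t x *\<^sub>C y) (comult a)"
proof -
  have "commuting comult (E t)"
    unfolding E_def by (intro commuting_conv_exp commuting_scale clin psi_linear psi_commuting)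
  then have "\<Phi> t = conv_left comult (E t) id"
    by (simp add: flow_conv_right commuting_def)
  then show ?thesis by (simp add: conv_left_def)
qed

lemma clinear_flow: "clinear (\<Phi> t)"
  unfolding flow_conv_right by (intro clinear_conv_right clinear_E clin)

lemma E_add: "conv_fun comult (E t) (E s) = E (t + s)"
proof -
  have l: "clinear (\<lambda>a. - complex_of_real t * \<psi> a)" for t by (intro clin psi_linear)
  have "commuting comult (\<lambda>a. - complex_of_real t * \<psi> a)"
    by (intro commuting_scale psi_linear psi_commuting)
  then have "conv_fun comult (E t) (E s) = conv_exp comult counit
      (\<lambda>a. - complex_of_real t * \<psi> a + - complex_of_real s * \<psi> a)"
    unfolding E_def using l commuting_iff[OF l] by (intro conv_exp_add) blast+
  also have "(\<lambda>a. - complex_of_real t * \<psi> a + - complex_of_real s * \<psi> a)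
      = (\<lambda>a. - complex_of_real (t + s) * \<psi> a)"
    by (auto simp: algebra_simps)
  finally show ?thesis by (simp only: E_def)
qed

lemma flow_add: "\<Phi> (t + s) a = \<Phi> t (\<Phi> s a)"
proof -
  have "\<Phi> t (\<Phi> s a) = conv_right comult (\<Phi> t) (E s) a"
    unfolding flow_conv_right[of s] by (rule linear_conv_right_id[OF clinear_flow])
  also have "\<dots> = conv_right comult id (conv_fun comult (E t) (E s)) a"
    unfolding flow_conv_right by (subst conv_right_assoc) (intro clin clinear_E refl)+
  finally show ?thesis by (simp add: E_add flow_conv_right)
qed

lemma flow_0: "\<Phi> 0 a = a"
  by (simp add: deformation_flow_def conv_exp_zero conv_right_counit clin)

lemma flow_cancel: "\<Phi> t (\<Phi> (- t) a) = a" "\<Phi> (- t) (\<Phi> t a) = a"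
  by (simp_all add: flow_add[symmetric] flow_0)

lemma flow_unit: "\<Phi> t unit = unit"
proof -
  have "conv_power comult counit (\<lambda>a. - complex_of_real t * \<psi> a) n unit = (if n = 0 then 1 else 0)" for n
  proof (cases n)
    case (Suc m)
    then show ?thesis
      using psi_normalized
      by (simp only: conv_power.simps, subst conv_fun_unit, (intro clin psi_linear clinear_conv_power)+)
        (simp add: normalized_def)
  qed (simp add: counit_unit)
  then have "E t unit = 1" unfolding E_def conv_exp_def by (subst suminf_finite[of "{0}"]) (auto simp: counit_unit)
  then show ?thesis
    by (simp add: flow_eq comult_unit) (subst tensor_lift_tensor', (intro clin clinear_E)+, simp add: scaleC_one)
qed

text \<open>
  By coassociativity the form \<open>\<Phi>\<^sub>s(a) = a\<^sub>1 e\<^sub>s(a\<^sub>2)\<close> makes \<open>\<Phi>\<^sub>s\<close> act on the right leg of a coproduct,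
  and the form \<open>\<Phi>\<^sub>t(a) = e\<^sub>t(a\<^sub>1) a\<^sub>2\<close> makes \<open>\<Phi>\<^sub>t\<close> act on the left leg.
\<close>

lemma comult_flow: "comult (\<Phi> (t + s) a) = tensor_map (\<Phi> t) (\<Phi> s) (comult a)"
proof -
  have r: "comult (\<Phi> s b) = tensor_map id (\<Phi> s) (comult b)" for b
    unfolding flow_conv_right by (rule comult_conv_right_id[OF clinear_E])
  have "\<Phi> t = conv_left comult (E t) id" by (auto simp: flow_eq_left conv_left_def)
  then have l: "comult (\<Phi> t b) = tensor_map (\<Phi> t) id (comult b)" for b
    using comult_conv_left_id[OF clinear_E] by simp
  have "tensor_map (\<Phi> t) id (tensor_map id (\<Phi> s) p) = tensor_map (\<Phi> t) (\<Phi> s) p" for p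
    by (rule tensor_ext[where t = p])
      ((intro clinear_compose[OF clinear_tensor_map] clinear_tensor_map clinear_flow clin)+,
       simp add: tensor_map_tensor clinear_flow clin)
  then show ?thesis by (simp add: flow_add l r)
qed

lemma deformation_tensor: "M t (a \<otimes> b) = \<Phi> t (\<Phi> (- t) a \<cdot> \<Phi> (- t) b)"
proof -
  have "inv (\<Phi> t) = \<Phi> (- t)" by (intro inv_unique_comp) (auto simp: flow_cancel)
  then show ?thesis by (simp add: trivial_deformation_def tensor_map_tensor clinear_flow)
qed

lemma clinear_deformation: "clinear (M t)"
proof -
  have "inv (\<Phi> t) = \<Phi> (- t)" by (intro inv_unique_comp) (auto simp: flow_cancel)
  then show ?thesis
    unfolding trivial_deformation_def Let_def comp_def
    by (auto intro!: clinear_compose[OF clinear_flow] clinear_compose[OF mult_linear] clinear_tensor_map clinear_flow)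
qed

lemma flow_mult: "M t (\<Phi> t a \<otimes> \<Phi> t b) = \<Phi> t (a \<cdot> b)"
  by (simp add: deformation_tensor flow_cancel)

lemma deformation_0: "M 0 = mult"
  by (rule ext, rule tensor_ext[OF clinear_deformation mult_linear]) (simp add: deformation_tensor flow_0)

lemma unital_algebra_deformation: "unital_algebra (M t) unit"
  by (rule unital_algebra.intro)
    (simp_all add: clinear_deformation deformation_tensor flow_cancel flow_unit mult_assoc
      mult_unit_left mult_unit_right)

text \<open>
  Every pair of elements comes from one under \<open>\<Phi>\<^sub>t\<^sub>+\<^sub>s\<close>, which intertwines \<open>\<mu>\<close> with \<open>\<mu>\<^sub>t\<^sub>+\<^sub>s\<close>; on the other side
  \<open>\<Phi>\<^sub>t \<otimes> \<Phi>\<^sub>s\<close> intertwines \<open>\<mu> \<otimes> \<mu>\<close> with \<open>\<mu>\<^sub>t \<otimes> \<mu>\<^sub>s\<close>.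
\<close>

lemma algebra_hom_comult:
  "algebra_hom (M (t + s)) unit (tensor_mult (M t) (M s)) (unit \<otimes> unit) comult"
proof -
  note lM = clinear_deformation
  have "comult (M (t + s) x) = tensor_mult (M t) (M s) (tensor_map comult comult x)" for x
  proof (rule tensor_ext[where t = x])
    show "clinear (\<lambda>x. comult (M (t + s) x))" by (rule clinear_compose[OF comult_linear lM])
    show "clinear (\<lambda>x. tensor_mult (M t) (M s) (tensor_map comult comult x))"
      by (rule clinear_compose[OF clinear_tensor_mult[OF lM lM] clinear_tensor_map[OF comult_linear comult_linear]])
    fix a b
    define a' b' where "a' = \<Phi> (- (t + s)) a" and "b' = \<Phi> (- (t + s)) b"
    then have ab: "a = \<Phi> (t + s) a'" "b = \<Phi> (t + s) b'" by (simp_all only: flow_cancel)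
    have "comult (M (t + s) (a \<otimes> b)) = tensor_map (\<Phi> t) (\<Phi> s) (comult a' \<odot> comult b')"
      by (simp only: ab flow_mult comult_flow comult_mult)
    also have "\<dots> = tensor_mult (M t) (M s) (tensor_map (\<Phi> t) (\<Phi> s) (comult a') \<otimes> tensor_map (\<Phi> t) (\<Phi> s) (comult b'))"
      by (intro tensor_mult_tensor_map[symmetric] lM mult_linear clinear_flow flow_mult)
    also have "\<dots> = tensor_mult (M t) (M s) (tensor_map comult comult (a \<otimes> b))"
      by (simp only: ab comult_flow tensor_map_tensor comult_linear)
    finally show "comult (M (t + s) (a \<otimes> b)) = tensor_mult (M t) (M s) (tensor_map comult comult (a \<otimes> b))" .
  qed
  then show ?thesis by (auto simp: algebra_hom_def comult_linear comult_unit)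
qed

lemma E_tendsto: "((\<lambda>t. E (c * t) a) \<longlongrightarrow> counit a) (at 0)"
  using conv_exp_tendsto[OF psi_linear, of "- c" a] by (simp add: E_def)

text \<open>
  Since \<open>\<delta> \<circ> \<Phi>\<^sub>t = e\<^sub>t\<close>, on a simple tensor the left-hand side is the finite sum
  \<open>e\<^sub>t(a\<^sub>1 b\<^sub>1) e\<^sub>-\<^sub>t(a\<^sub>2) e\<^sub>-\<^sub>t(b\<^sub>2)\<close>, and each factor tends to the counit.
\<close>

lemma counit_deformation_tendsto:
  "((\<lambda>t. counit (M t x)) \<longlongrightarrow> tensor_lift (\<lambda>a b. counit a * counit b) x) (at 0)"
proof -
  have counit_flow: "counit (\<Phi> t a) = E t a" for t a
  proof -
    have "counit (\<Phi> t a) = conv_fun comult counit (E t) a"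
      by (simp add: flow_eq linear_tensor_lift[OF counit_linear] clinear_scale[OF counit_linear]
          conv_fun_def scaleC_complex_def mult.commute)
    then show ?thesis by (simp add: conv_fun_counit_left clinear_E)
  qed
  have tensor: "((\<lambda>t. counit (M t (a \<otimes> b))) \<longlongrightarrow> counit a * counit b) (at 0)" for a b
  proof -
    have "counit (M t (a \<otimes> b)) = tensor_lift (\<lambda>x y. tensor_lift (\<lambda>u v.
        E (- t) y * (E (- t) v * E t (x \<cdot> u))) (comult b)) (comult a)" for t
    proof -
      have right: "E t (c \<cdot> \<Phi> (- t) b) = tensor_lift (\<lambda>u v. E (- t) v * E t (c \<cdot> u)) (comult b)" for c
      proof -
        have l: "clinear (\<lambda>b. E t (c \<cdot> b))" by (intro clinear_compose[OF clinear_E] bilin)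
        show ?thesis
          by (simp add: flow_eq linear_tensor_lift[OF l] clinear_scale[OF l] scaleC_complex_def)
      qed
      have left: "E t (\<Phi> (- t) a \<cdot> d) = tensor_lift (\<lambda>x y. E (- t) y * E t (x \<cdot> d)) (comult a)" for d
      proof -
        have l: "clinear (\<lambda>a. E t (a \<cdot> d))" by (intro clinear_compose[OF clinear_E] bilin)
        show ?thesis
          by (simp add: flow_eq linear_tensor_lift[OF l] clinear_scale[OF l] scaleC_complex_def)
      qed
      show ?thesis
        unfolding deformation_tensor counit_flow left right
        by (subst linear_tensor_lift[where h = "\<lambda>z. c * z" for c], intro clin)
          (subst tensor_lift_swap, simp only: mult.left_commute)
    qed
    moreover have "((\<lambda>t. tensor_lift (\<lambda>x y. tensor_lift (\<lambda>u v.
        E (- t) y * (E (- t) v * E t (x \<cdot> u))) (comult b)) (comult a)) \<longlongrightarrow>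
        tensor_lift (\<lambda>x y. tensor_lift (\<lambda>u v.
        counit y * (counit v * counit (x \<cdot> u))) (comult b)) (comult a)) (at 0)"
      using E_tendsto[of 1] E_tendsto[of "- 1"]
      by (intro tensor_lift_tendsto tendsto_mult) simp_all
    moreover have "tensor_lift (\<lambda>x y. tensor_lift (\<lambda>u v.
        counit y * (counit v * counit (x \<cdot> u))) (comult b)) (comult a) = counit a * counit b"
    proof -
      have "tensor_lift (\<lambda>u v. counit y * (counit v * counit (x \<cdot> u))) (comult b)
          = counit y * (counit x * counit b)" for x y
        using sweedler_counit_right[of "\<lambda>u. counit y * counit (x \<cdot> u)" b]
        by (simp add: scaleC_complex_def counit_mult bilin counit_linear mult_ac)
      moreover have "tensor_lift (\<lambda>x y. counit y * (counit x * counit b)) (comult a) = counit a * counit b"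
        using sweedler_counit_right[of "\<lambda>x. counit x * counit b" a]
        by (simp add: scaleC_complex_def bilin counit_linear)
      ultimately show ?thesis by simp
    qed
    ultimately show ?thesis by simp
  qed
  have "counit (M t x) = tensor_lift (\<lambda>a b. counit (M t (a \<otimes> b))) x" for t
    using linear_tensor_lift[OF clinear_compose[OF counit_linear clinear_deformation], of t "(\<otimes>)" x]
    by (simp add: tensor_lift_tensor_self)
  with tensor_lift_tendsto[OF tensor] show ?thesis by simp
qed

lemma additive_deformation_flow: "additive_deformation mult unit comult counit M"
  unfolding additive_deformation_def
  using unital_algebra_deformation deformation_0 algebra_hom_comult counit_deformation_tendsto by blast

end

section \<open>The deformed antipode\<close>

locale hopf_commuting_functional =
  hopf_algebra mult unit comult counit antipode + commuting_functional mult unit comult counit \<psi>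
  for mult :: "'a::complex_vector \<otimes> 'a \<Rightarrow> 'a" and unit comult counit antipode \<psi>
begin

text \<open>
  Rewriting \<open>\<Delta>\<close> as \<open>(\<Phi>\<^sub>s \<otimes> \<Phi>\<^sub>-\<^sub>s) \<circ> \<Delta>\<close>, with \<open>s = -t\<close> for the left equation and \<open>s = t\<close> for the right one,
  cancels the inner \<open>\<Phi>\<^sub>t\<close> and puts an outer \<open>\<Phi>\<^sub>t\<close> on the other factor.
\<close>

lemma deformed_antipode_flow: "deformed_antipode (M t) unit comult counit (\<Phi> t \<circ> antipode \<circ> \<Phi> t)"
proof -
  let ?T = "\<Phi> t \<circ> antipode \<circ> \<Phi> t"
  have T: "clinear ?T"
    unfolding comp_def by (intro clinear_compose[OF clinear_flow] hlin clinear_flow)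
  have twist: "tensor_lift f (comult a) = tensor_lift (\<lambda>x y. f (\<Phi> s x) (\<Phi> (- s) y)) (comult a)"
    if "\<And>a. clinear (\<lambda>b. f a b)" "\<And>b. clinear (\<lambda>a. f a b)" for f :: "'a \<Rightarrow> 'a \<Rightarrow> 'a" and s a
    using comult_flow[of s "- s" a] tensor_lift_tensor_map[OF that, of "\<Phi> s" "\<Phi> (- s)" "comult a"]
    by (simp add: flow_0)
  have l: "clinear (\<lambda>b. M t (f a \<otimes> g b))" "clinear (\<lambda>a. M t (f a \<otimes> g b))" if "clinear f" "clinear g" for f g a b
    by (intro clinear_compose[OF clinear_deformation] clin that)+
  have flow_counit: "\<Phi> t (counit a *\<^sub>C unit) = counit a *\<^sub>C unit" for a
    by (simp add: clinear_scale[OF clinear_flow] flow_unit)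
  have "M t (tensor_map ?T id (comult a)) = counit a *\<^sub>C unit" for a
  proof -
    have "M t (tensor_map ?T id (comult a)) = tensor_lift (\<lambda>x y. M t (?T x \<otimes> y)) (comult a)"
      by (simp add: tensor_map_def linear_tensor_lift[OF clinear_deformation])
    also have "\<dots> = tensor_lift (\<lambda>x y. \<Phi> t (antipode x \<cdot> y)) (comult a)"
      by (subst twist[where s = "- t"], (intro l[OF T clinear_ident])+)
        (simp add: flow_cancel flow_mult)
    also have "\<dots> = counit a *\<^sub>C unit"
      by (simp add: linear_tensor_lift[OF clinear_flow, symmetric] sweedler_antipode_left flow_counit)
    finally show ?thesis .
  qed
  moreover have "M t (tensor_map id ?T (comult a)) = counit a *\<^sub>C unit" for a
  proof -
    have "M t (tensor_map id ?T (comult a)) = tensor_lift (\<lambda>x y. M t (x \<otimes> ?T y)) (comult a)"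
      by (simp add: tensor_map_def linear_tensor_lift[OF clinear_deformation])
    also have "\<dots> = tensor_lift (\<lambda>x y. \<Phi> t (x \<cdot> antipode y)) (comult a)"
      by (subst twist[where s = t], (intro l[OF clinear_ident T])+)
        (simp add: flow_cancel flow_mult)
    also have "\<dots> = counit a *\<^sub>C unit"
      by (simp add: linear_tensor_lift[OF clinear_flow, symmetric] sweedler_antipode_right flow_counit)
    finally show ?thesis .
  qed
  ultimately show ?thesis using T by (auto simp: deformed_antipode_def)
qed

text \<open>
  The form \<open>\<Phi>\<^sub>t(b) = e\<^sub>t(b\<^sub>1) b\<^sub>2\<close> is the useful one at \<open>b = S(a)\<close>: the order reversal by \<open>S\<close> turns it
  into \<open>S(a\<^sub>1) e\<^sub>t(S(a\<^sub>2))\<close>, a right convolution like the remaining factor \<open>e\<^sub>t\<close>.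
\<close>

lemma flow_antipode_flow:
  "\<Phi> t \<circ> antipode \<circ> \<Phi> t =
    conv_right comult antipode (conv_exp comult counit (\<lambda>a. - complex_of_real t * (\<psi> (antipode a) + \<psi> a)))"
proof -
  let ?f = "\<lambda>a. - complex_of_real t * \<psi> a"
  have f: "clinear ?f" "clinear (\<lambda>a. ?f (antipode a))"
    by (intro clin psi_linear clinear_compose[OF psi_linear] antipode_linear)+
  have comm: "conv_fun comult (\<lambda>a. ?f (antipode a)) ?f = conv_fun comult ?f (\<lambda>a. ?f (antipode a))"
    using commuting_scale[OF psi_linear psi_commuting] commuting_iff[OF f(1)] f(2) by metis
  have ES: "(\<lambda>a. E t (antipode a)) = conv_exp comult counit (\<lambda>a. ?f (antipode a))"
    unfolding E_def using conv_exp_antipode[OF f(1)] by blast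
  have flow_S: "\<Phi> t (antipode a) = conv_right comult antipode (\<lambda>a. E t (antipode a)) a" for a
    unfolding flow_eq_left conv_right_def
    by (subst sweedler_antipode) (intro clin clinear_E refl)+
  have l: "clinear (\<lambda>a. \<Phi> t (antipode a))" by (intro clinear_compose[OF clinear_flow] antipode_linear)
  have "\<Phi> t (antipode (\<Phi> t a)) = conv_right comult antipode (conv_exp comult counit
    (\<lambda>a. - complex_of_real t * (\<psi> (antipode a) + \<psi> a))) a" for a
  proof -
    have "\<Phi> t (antipode (\<Phi> t a)) = conv_right comult (\<lambda>a. \<Phi> t (antipode a)) (E t) a"
      using linear_conv_right_id[OF l] by (simp add: flow_conv_right)
    also have "\<dots> = conv_right comult antipode (conv_fun comult (\<lambda>a. E t (antipode a)) (E t)) a"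
      unfolding flow_S
      by (subst conv_right_assoc) (intro antipode_linear clinear_E clinear_compose[OF clinear_E] refl)+
    also have "conv_fun comult (\<lambda>a. E t (antipode a)) (E t)
      = conv_exp comult counit (\<lambda>a. ?f (antipode a) + ?f a)"
      unfolding ES unfolding E_def by (intro conv_exp_add f comm)
    finally show ?thesis by (simp add: distrib_left)
  qed
  then show ?thesis by auto
qed

lemma hopf_deformation_flow: "hopf_deformation mult unit comult counit M"
  unfolding hopf_deformation_def using additive_deformation_flow deformed_antipode_flow by blast

end

theorem theorem4:
  fixes mult :: "'a::complex_vector \<otimes> 'a \<Rightarrow> 'a"
    and unit :: 'a
    and comult :: "'a \<Rightarrow> 'a \<otimes> 'a"
    and counit :: "'a \<Rightarrow> complex"
    and S :: "'a \<Rightarrow> 'a"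
    and \<psi> :: "'a \<Rightarrow> complex"
    and \<Phi> :: "real \<Rightarrow> 'a \<Rightarrow> 'a"
    and M :: "real \<Rightarrow> 'a \<otimes> 'a \<Rightarrow> 'a"
  assumes "hopf_algebra mult unit comult counit S"
    and "clinear \<psi>" and "commuting comult \<psi>" and "normalized unit \<psi>"
    and "\<Phi> = deformation_flow comult counit \<psi>"
    and "M = trivial_deformation mult comult counit \<psi>"
  shows "(\<forall>t. \<Phi> t \<circ> S \<circ> \<Phi> t =
            conv_right comult S (conv_exp comult counit (\<lambda>a. - complex_of_real t * (\<psi> (S a) + \<psi> a)))
          \<and> deformed_antipode (M t) unit comult counit (\<Phi> t \<circ> S \<circ> \<Phi> t))
      \<and> hopf_deformation mult unit comult counit M"
proof -
  have "commuting_functional mult unit comult counit \<psi>"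
    using hopf_algebra.axioms(1)[OF assms(1)] assms(2-4)
    by (intro commuting_functional.intro commuting_functional_axioms.intro)
  then interpret hopf_commuting_functional mult unit comult counit S \<psi>
    by (rule hopf_commuting_functional.intro[OF assms(1)])
  show ?thesis
    unfolding assms(5,6)
    by (intro conjI allI flow_antipode_flow deformed_antipode_flow hopf_deformation_flow)
qed

end
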